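(* Let $(\alpha_j)_{j\ge 1}$ be a sequence of reals in $(0,1)$ with $\alpha_j \to 0$, and let $(r_j)_{j\ge1}$ be a sequence of positive integers such that $r_j \ge (1/\alpha_j)^{\omega_j}$ for some sequence $\omega_j \to \infty$ (equivalently, $\log r_j / \log(1/\alpha_j) \to \infty$). Let $N(\alpha,r)$ denote the maximum number of $\alpha$-equiangular lines in $\mathbb{R}^r$. Then $$N(\alpha_j, r_j) = r_j + o(r_j) \quad \text{as } j \to \infty.$$
   Context: For $\alpha \in [0,1)$, a family of lines through the origin in $\mathbb{R}^r$ is called $\alpha$-equiangular if the acute angle between any two distinct lines of the family equals $\arccos \alpha$ (equivalently, choosing a unit vector on each line, any two distinct chosen vectors $\mathbf{u},\mathbf{v}$ satisfy $|\langle \mathbf{u},\mathbf{v}\rangle| = \alpha$). *)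

theory Defs
  imports Complex_Main "HOL-Library.Landau_Symbols" "Jordan_Normal_Form.Matrix"
begin

text \<open>
  Since the dimension varies along a sequence, Euclidean r-space is the carrier
  \<^term>\<open>carrier_vec r\<close> of real vectors of length r, with the standard scalar product.
\<close>

definition lines_through_origin :: "nat \<Rightarrow> real vec set set" where
  "lines_through_origin r =
     {{c \<cdot>\<^sub>v v | c. True} | v. v \<in> carrier_vec r \<and> v \<noteq> 0\<^sub>v r}"

definition euclid_norm :: "real vec \<Rightarrow> real" where
  "euclid_norm v = sqrt (scalar_prod v v)"

text \<open>
  The non-obtuse angle between the lines spanned by two nonzero vectors; it does not depend
  on the spanning vectors chosen.
\<close>

definition acute_angle :: "real vec \<Rightarrow> real vec \<Rightarrow> real" where
  "acute_angle u v = arccos (\<bar>scalar_prod u v\<bar> / (euclid_norm u * euclid_norm v))"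

definition equiangular :: "real \<Rightarrow> nat \<Rightarrow> real vec set set \<Rightarrow> bool" where
  "equiangular \<alpha> r L \<longleftrightarrow>
     L \<subseteq> lines_through_origin r \<and>
     (\<forall>l\<in>L. \<forall>m\<in>L. l \<noteq> m \<longrightarrow>
        (\<forall>u\<in>l - {0\<^sub>v r}. \<forall>v\<in>m - {0\<^sub>v r}. acute_angle u v = arccos \<alpha>))"

text \<open>
  For \<open>0 \<le> \<alpha> < 1\<close> an equiangular family in r-space has at most \<open>r * (r + 1) / 2\<close> lines
  (Gerzon), so restricting to finite families excludes nothing and the maximum below is over
  a finite set, which is nonempty because the empty family is equiangular.
\<close>

definition max_equiangular :: "real \<Rightarrow> nat \<Rightarrow> nat" where
  "max_equiangular \<alpha> r = Max {card L | L. finite L \<and> equiangular \<alpha> r L}"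

end

theory Submission
  imports Defs
begin

text \<open>
  Choose unit vectors on the lines, fix one of them, and change signs so that it has inner product
  \<open>\<alpha>\<close> with all the others. The Gram matrix of the others is \<open>(1 - \<alpha>) I + \<alpha> J - 2 \<alpha> A\<close> with \<open>A\<close> the
  adjacency matrix of the graph of negative inner products. After removal of polynomially many
  (in \<open>1 / \<alpha>\<close>) vertices this graph has maximum degree at most \<open>\<Delta> = 1 / \<alpha> ^ 4\<close>. As the Gram matrix
  has rank at most \<open>r\<close>, all but \<open>r + 1\<close> dimensions belong to the eigenvalue \<open>\<mu> = (1 - \<alpha>) / (2 \<alpha>)\<close> of \<open>A\<close>,
  so it suffices to bound its multiplicity.

  Because the Gram matrix is positive semidefinite, outside one ball of radius \<open>2 k + 1\<close> every vertex has
  at most \<open>\<mu> ^ (2 k)\<close> closed walks of length \<open>2 k\<close>. Delete each vertex with a small probability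
  \<open>1 - \<theta>\<close>: eigenvectors that vanish on the deleted vertices stay eigenvectors, while only closed
  walks with at most \<open>S\<close> distinct vertices survive with probability more than \<open>\<theta> ^ S\<close>, and there are at
  most \<open>(S + 1) ^ (2 k) * \<Delta> ^ (S - 1)\<close> of these per vertex, negligible against \<open>\<mu> ^ (2 k)\<close> for \<open>k = 2 S\<close>.
  The trace of the \<open>2 k\<close>-th power of the adjacency matrix therefore shows that the multiplicity is
  a small proportion of the vertices.
\<close>

section \<open>Linear algebra over finite index sets\<close>

text \<open>Gaussian elimination, one equation per induction step. The solution is made zero outside
  \<open>V\<close>, so that it can later be summed over any larger set.\<close>

lemma homogeneous_solution:
  fixes c :: "'i \<Rightarrow> 'a \<Rightarrow> real"
  assumes "finite I" "finite V" "card I < card V"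
  shows "\<exists>x. (\<exists>v\<in>V. x v \<noteq> 0) \<and> (\<forall>v. v \<notin> V \<longrightarrow> x v = 0) \<and> (\<forall>i\<in>I. (\<Sum>v\<in>V. c i v * x v) = 0)"
  using assms
proof (induction I arbitrary: V c rule: finite_induct)
  case empty
  then obtain v where "v \<in> V" by fastforce
  then show ?case
    by (intro exI[of _ "\<lambda>u. if u = v then 1 else 0"]) auto
next
  case (insert i I)
  show ?case
  proof (cases "\<forall>v\<in>V. c i v = 0")
    case True
    have "card I < card V" using insert by simp
    from insert.IH[OF insert.prems(1) this, of c] True show ?thesis by auto
  next
    case False
    then obtain a where a: "a \<in> V" "c i a \<noteq> 0" by blast
    \<comment> \<open>Subtracting the multiple \<open>c j a / c i a\<close> of equation
      \<open>i\<close> removes the unknown at the pivot \<open>a\<close> from equation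
      \<open>j\<close>.\<close>
    define c' where "c' = (\<lambda>j v. c j v - c j a * c i v / c i a)"
    have "card I < card (V - {a})" using insert a by simp
    from insert.IH[OF _ this, of c'] insert.prems(1) obtain x
      where x: "\<exists>v\<in>V - {a}. x v \<noteq> 0" "\<forall>v. v \<notin> V - {a} \<longrightarrow> x v = 0"
        "\<forall>j\<in>I. (\<Sum>v\<in>V - {a}. c' j v * x v) = 0" by auto
    define s where "s = (\<Sum>v\<in>V - {a}. c i v * x v)"
    \<comment> \<open>Back substitution: equation \<open>i\<close> forces this value at
      \<open>a\<close>.\<close>
    define y where "y = x(a := - s / c i a)"
    have split: "(\<Sum>v\<in>V. c j v * y v) = - c j a * s / c i a + (\<Sum>v\<in>V - {a}. c j v * x v)" for j
      using insert.prems(1) a by (subst sum.remove[of _ a]) (auto simp: y_def intro!: sum.cong)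
    have "(\<Sum>v\<in>V. c j v * y v) = 0" if "j \<in> I" for j
    proof -
      have "0 = (\<Sum>v\<in>V - {a}. c j v * x v - c j a / c i a * (c i v * x v))"
        using x(3)[rule_format, OF that, symmetric] unfolding c'_def by (simp add: left_diff_distrib mult.assoc)
      also have "\<dots> = (\<Sum>v\<in>V - {a}. c j v * x v) - c j a / c i a * s"
        by (simp add: sum_subtractf s_def sum_distrib_left)
      finally show ?thesis using split[of j] by simp
    qed
    moreover have "(\<Sum>v\<in>V. c i v * y v) = 0"
      using split[of i] a by (simp add: s_def)
    moreover have "\<exists>v\<in>V. y v \<noteq> 0" using x(1) by (auto simp: y_def)
    moreover have "\<forall>v. v \<notin> V \<longrightarrow> y v = 0" using x(2) a by (auto simp: y_def)
    ultimately show ?thesis by (intro exI[of _ y]) auto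
  qed
qed

text \<open>Orthogonality to the vectors already found is again a homogeneous linear equation, so
  each new vector solves an enlarged system and only has to be normalised.\<close>

lemma orthonormal_solutions:
  fixes c :: "'i \<Rightarrow> 'a \<Rightarrow> real"
  assumes "finite I" "finite V" "card I + t \<le> card V"
  shows "\<exists>y :: nat \<Rightarrow> 'a \<Rightarrow> real. \<forall>s<t. (\<forall>v. v \<notin> V \<longrightarrow> y s v = 0) \<and>
      (\<forall>i\<in>I. (\<Sum>v\<in>V. c i v * y s v) = 0) \<and>
      (\<forall>s'<t. (\<Sum>v\<in>V. y s v * y s' v) = of_bool (s = s'))"
  using assms(3)
proof (induction t)
  case 0
  then show ?case by simp
next
  case (Suc t)
  then obtain y :: "nat \<Rightarrow> 'a \<Rightarrow> real" where Y: "\<forall>s<t. (\<forall>v. v \<notin> V \<longrightarrow> y s v = 0) \<and>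
      (\<forall>i\<in>I. (\<Sum>v\<in>V. c i v * y s v) = 0) \<and>
      (\<forall>s'<t. (\<Sum>v\<in>V. y s v * y s' v) = of_bool (s = s'))" by auto
  have y: "\<And>s v. s < t \<Longrightarrow> v \<notin> V \<Longrightarrow> y s v = 0"
    "\<And>s i. s < t \<Longrightarrow> i \<in> I \<Longrightarrow> (\<Sum>v\<in>V. c i v * y s v) = 0"
    "\<And>s s'. s < t \<Longrightarrow> s' < t \<Longrightarrow> (\<Sum>v\<in>V. y s v * y s' v) = of_bool (s = s')"
    using Y by blast+
  have "card (Inl ` I \<union> Inr ` {..<t} :: ('i + nat) set) = card I + t"
    using assms(1) by (subst card_Un_disjoint) (auto simp: card_image)
  then have "card (Inl ` I \<union> Inr ` {..<t} :: ('i + nat) set) < card V"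
    using Suc.prems by simp
  from homogeneous_solution[OF _ assms(2) this, of "case_sum c y"] assms(1) obtain x where x:
    "\<exists>v\<in>V. x v \<noteq> 0" "\<forall>v. v \<notin> V \<longrightarrow> x v = 0"
    "\<forall>i\<in>Inl ` I \<union> Inr ` {..<t}. (\<Sum>v\<in>V. case_sum c y i v * x v) = 0"
    by auto
  define m where "m = (\<Sum>v\<in>V. x v * x v)"
  obtain w where "w \<in> V" "x w \<noteq> 0" using x(1) by blast
  then have "m > 0"
    unfolding m_def by (intro sum_pos2[OF assms(2), of w]) (auto simp: zero_less_mult_iff)
  define z where "z = (\<lambda>v. x v / sqrt m)"
  have "(\<Sum>v\<in>V. z v * z v) = (\<Sum>v\<in>V. x v * x v / m)"
    using \<open>m > 0\<close> by (intro sum.cong) (auto simp: z_def)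
  also have "\<dots> = 1" using \<open>m > 0\<close> by (simp add: sum_divide_distrib[symmetric] m_def)
  finally have zz: "(\<Sum>v\<in>V. z v * z v) = 1" .
  have zy: "(\<Sum>v\<in>V. d v * z v) = (\<Sum>v\<in>V. d v * x v) / sqrt m" for d
    by (simp add: z_def sum_divide_distrib)
  have yz: "(\<Sum>v\<in>V. y s v * z v) = 0" if "s < t" for s
    unfolding zy using x(3)[rule_format, of "Inr s"] that by simp
  have zy': "(\<Sum>v\<in>V. z v * y s v) = 0" if "s < t" for s
    using yz[OF that] by (simp add: mult.commute)
  have cz: "(\<Sum>v\<in>V. c i v * z v) = 0" if "i \<in> I" for i
    unfolding zy using x(3)[rule_format, of "Inl i"] that by simp
  have zV: "z v = 0" if "v \<notin> V" for v using x(2) that by (simp add: z_def)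
  show ?case
    by (rule exI[of _ "y(t := z)"])
      (use x(2) in \<open>auto simp: less_Suc_eq y yz zy' cz zz zV\<close>)
qed

text \<open>The squared distance from \<open>z\<close> to its projection onto the span of the
  orthonormal \<open>y s\<close> is nonnegative.\<close>

lemma bessel:
  fixes y :: "nat \<Rightarrow> 'a \<Rightarrow> real"
  assumes "finite V"
    and ortho: "\<And>s s'. s < t \<Longrightarrow> s' < t \<Longrightarrow> (\<Sum>v\<in>V. y s v * y s' v) = of_bool (s = s')"
  shows "(\<Sum>s<t. (\<Sum>v\<in>V. z v * y s v)\<^sup>2) \<le> (\<Sum>v\<in>V. (z v)\<^sup>2)"
proof -
  define c where "c = (\<lambda>s. \<Sum>v\<in>V. z v * y s v)"
  have cross: "(\<Sum>v\<in>V. z v * (\<Sum>s<t. c s * y s v)) = (\<Sum>s<t. (c s)\<^sup>2)"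
  proof -
    have "(\<Sum>v\<in>V. z v * (\<Sum>s<t. c s * y s v)) = (\<Sum>s<t. \<Sum>v\<in>V. z v * (c s * y s v))"
      by (simp add: sum_distrib_left) (rule sum.swap)
    also have "\<dots> = (\<Sum>s<t. c s * (\<Sum>v\<in>V. z v * y s v))"
      by (simp add: sum_distrib_left mult_ac)
    finally show ?thesis by (simp add: c_def power2_eq_square)
  qed
  have quad: "(\<Sum>v\<in>V. (\<Sum>s<t. c s * y s v)\<^sup>2) = (\<Sum>s<t. (c s)\<^sup>2)"
  proof -
    have "(\<Sum>v\<in>V. (\<Sum>s<t. c s * y s v)\<^sup>2)
        = (\<Sum>v\<in>V. \<Sum>s<t. \<Sum>s'<t. (c s * y s v) * (c s' * y s' v))"
      by (simp add: power2_eq_square sum_product)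
    also have "\<dots> = (\<Sum>s<t. \<Sum>s'<t. \<Sum>v\<in>V. (c s * y s v) * (c s' * y s' v))"
      by (subst sum.swap) (intro sum.cong refl sum.swap)
    also have "\<dots> = (\<Sum>s<t. \<Sum>s'<t. c s * c s' * (\<Sum>v\<in>V. y s v * y s' v))"
      by (simp add: sum_distrib_left mult_ac)
    also have "\<dots> = (\<Sum>s<t. \<Sum>s'<t. c s * c s' * of_bool (s = s'))"
      by (intro sum.cong refl) (simp add: ortho)
    also have "\<dots> = (\<Sum>s<t. (c s)\<^sup>2)"
    proof (intro sum.cong refl)
      fix s assume "s \<in> {..<t}"
      have "(\<Sum>s'<t. c s * c s' * of_bool (s = s')) = (\<Sum>s'<t. if s = s' then c s * c s' else 0)"
        by (intro sum.cong) auto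
      with \<open>s \<in> {..<t}\<close> show "(\<Sum>s'<t. c s * c s' * of_bool (s = s')) = (c s)\<^sup>2"
        by (simp add: power2_eq_square)
    qed
    finally show ?thesis .
  qed
  have "0 \<le> (\<Sum>v\<in>V. (z v - (\<Sum>s<t. c s * y s v))\<^sup>2)" by (intro sum_nonneg) auto
  also have "\<dots> = (\<Sum>v\<in>V. (z v)\<^sup>2 - 2 * (z v * (\<Sum>s<t. c s * y s v)) + (\<Sum>s<t. c s * y s v)\<^sup>2)"
    by (simp add: power2_diff algebra_simps)
  also have "\<dots> = (\<Sum>v\<in>V. (z v)\<^sup>2) - 2 * (\<Sum>s<t. (c s)\<^sup>2) + (\<Sum>s<t. (c s)\<^sup>2)"
    by (simp only: sum.distrib sum_subtractf sum_distrib_left[symmetric] cross quad)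
  finally show ?thesis by (simp add: c_def)
qed

section \<open>Walks and balls\<close>

text \<open>For \<open>v\<close> and \<open>u\<close> in \<open>K\<close> this is an entry of the
  \<open>n\<close>-th power of the adjacency matrix of the subgraph induced on \<open>K\<close>.
  Only the vertices after the start are required to lie in \<open>K\<close>.\<close>

primrec walks :: "('a \<Rightarrow> 'a \<Rightarrow> bool) \<Rightarrow> 'a set \<Rightarrow> nat \<Rightarrow> 'a \<Rightarrow> 'a \<Rightarrow> real" where
  "walks E K 0 v u = of_bool (v = u)"
| "walks E K (Suc n) v u = (\<Sum>w\<in>K. of_bool (E v w) * walks E K n w u)"

lemma walks_nonneg: "walks E K n v u \<ge> 0"
  by (induction n arbitrary: v) (auto intro!: sum_nonneg)

lemma walks_add:
  assumes "finite K" "v \<in> K"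
  shows "walks E K (m + n) v u = (\<Sum>w\<in>K. walks E K m v w * walks E K n w u)"
  using assms(2)
proof (induction m arbitrary: v)
  case 0
  have "(\<Sum>w\<in>K. walks E K 0 v w * walks E K n w u) = (\<Sum>w\<in>K. if v = w then walks E K n w u else 0)"
    by (intro sum.cong) auto
  with 0 assms(1) show ?case by simp
next
  case (Suc m)
  have "walks E K (Suc m + n) v u
      = (\<Sum>w\<in>K. of_bool (E v w) * (\<Sum>w'\<in>K. walks E K m w w' * walks E K n w' u))"
    using Suc.IH by simp
  also have "\<dots> = (\<Sum>w\<in>K. \<Sum>w'\<in>K. of_bool (E v w) * walks E K m w w' * walks E K n w' u)"
    by (simp add: sum_distrib_left mult_ac)
  also have "\<dots> = (\<Sum>w'\<in>K. \<Sum>w\<in>K. of_bool (E v w) * walks E K m w w' * walks E K n w' u)"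
    by (rule sum.swap)
  also have "\<dots> = (\<Sum>w'\<in>K. walks E K (Suc m) v w' * walks E K n w' u)"
    by (simp add: sum_distrib_right)
  finally show ?case .
qed

lemma walks_1:
  assumes "finite K" "u \<in> K"
  shows "walks E K (Suc 0) v u = of_bool (E v u)"
proof -
  have "walks E K (Suc 0) v u = (\<Sum>w\<in>K. if u = w then of_bool (E v w) else 0)"
    by (auto intro!: sum.cong)
  then show ?thesis using assms by simp
qed

lemma walks_sym:
  assumes "finite K" "symp E" "v \<in> K" "u \<in> K"
  shows "walks E K n v u = walks E K n u v"
  using assms(3,4)
proof (induction n arbitrary: v u)
  case 0
  then show ?case by auto
next
  case (Suc n)
  have "walks E K (Suc n) v u = (\<Sum>w\<in>K. of_bool (E v w) * walks E K n w u)" by simp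
  also have "\<dots> = (\<Sum>w\<in>K. walks E K n u w * walks E K (Suc 0) w v)"
  proof (intro sum.cong refl)
    fix w assume "w \<in> K"
    moreover have "E v w = E w v" using assms(2) by (blast dest: sympD)
    ultimately show "of_bool (E v w) * walks E K n w u = walks E K n u w * walks E K (Suc 0) w v"
      using Suc walks_1[OF assms(1), of v] by simp
  qed
  also have "\<dots> = walks E K (n + Suc 0) u v"
    using assms(1) Suc.prems by (simp only: walks_add)
  finally show ?case by simp
qed

section \<open>Balls in the graph metric\<close>

primrec gball :: "('a \<Rightarrow> 'a \<Rightarrow> bool) \<Rightarrow> 'a set \<Rightarrow> nat \<Rightarrow> 'a \<Rightarrow> 'a set" where
  "gball E W 0 v = {v}"
| "gball E W (Suc n) v = gball E W n v \<union> {w\<in>W. \<exists>u\<in>gball E W n v. E u w}"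

lemma gball_mono: "m \<le> n \<Longrightarrow> gball E W m v \<subseteq> gball E W n v"
  by (rule lift_Suc_mono_le[of "\<lambda>n. gball E W n v"]) auto

lemma gball_subset: "v \<in> W \<Longrightarrow> gball E W n v \<subseteq> W"
  by (induction n) auto

lemma gball_trans: "u \<in> gball E W m v \<Longrightarrow> w \<in> gball E W n u \<Longrightarrow> w \<in> gball E W (m + n) v"
proof (induction n arbitrary: w)
  case 0
  then show ?case by simp
next
  case (Suc n)
  then show ?case by auto
qed

lemma gball_sym:
  assumes "symp E" "v \<in> W" "u \<in> gball E W n v"
  shows "v \<in> gball E W n u"
  using assms(3)
proof (induction n arbitrary: u)
  case 0
  then show ?case by simp
next
  case (Suc n)
  show ?case
  proof (cases "u \<in> gball E W n v")
    case True
    then show ?thesis using Suc.IH by simp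
  next
    case False
    then obtain w where w: "w \<in> gball E W n v" "E w u" "u \<in> W" using Suc.prems by auto
    then have "v \<in> gball E W n w" "w \<in> gball E W (Suc 0) u"
      using Suc.IH gball_subset[OF assms(2)] assms(1) by (auto dest: sympD)
    from gball_trans[OF this(2,1)] show ?thesis by simp
  qed
qed

lemma card_gball:
  fixes \<Delta> :: real
  assumes "finite W" "v \<in> W" and deg: "\<And>v. v \<in> W \<Longrightarrow> real (card {w\<in>W. E v w}) \<le> \<Delta>"
  shows "real (card (gball E W n v)) \<le> (1 + \<Delta>) ^ n"
proof (induction n)
  case 0
  then show ?case by simp
next
  case (Suc n)
  have fin: "finite (gball E W n v)" using gball_subset[OF assms(2)] assms(1) by (rule finite_subset)
  have "0 \<le> \<Delta>" using deg[OF assms(2)] by linarith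
  have "gball E W (Suc n) v = gball E W n v \<union> (\<Union>u\<in>gball E W n v. {w\<in>W. E u w})" by auto
  then have "card (gball E W (Suc n) v) \<le> card (gball E W n v) + (\<Sum>u\<in>gball E W n v. card {w\<in>W. E u w})"
    using card_Un_le[of "gball E W n v" "\<Union>u\<in>gball E W n v. {w\<in>W. E u w}"]
      card_UN_le[OF fin, of "\<lambda>u. {w\<in>W. E u w}"] by simp
  then have "real (card (gball E W (Suc n) v))
      \<le> real (card (gball E W n v)) + (\<Sum>u\<in>gball E W n v. real (card {w\<in>W. E u w}))"
    unfolding of_nat_sum[symmetric] of_nat_add[symmetric] of_nat_le_iff .
  also have "\<dots> \<le> real (card (gball E W n v)) + (\<Sum>u\<in>gball E W n v. \<Delta>)"
    using gball_subset[OF assms(2)] by (intro add_left_mono sum_mono deg) auto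
  also have "\<dots> = real (card (gball E W n v)) * (1 + \<Delta>)" by (simp add: algebra_simps)
  also have "\<dots> \<le> (1 + \<Delta>) ^ n * (1 + \<Delta>)" using Suc \<open>0 \<le> \<Delta>\<close> by (intro mult_right_mono) auto
  finally show ?case by (simp add: mult.commute)
qed

lemma walks_eq_0:
  assumes "v \<in> W" "u \<in> W" "u \<notin> gball E W n v"
  shows "walks E W n v u = 0"
  using assms
proof (induction n arbitrary: v)
  case 0
  then show ?case by auto
next
  case (Suc n)
  have "of_bool (E v w) * walks E W n w u = 0" if "w \<in> W" for w
  proof (cases "E v w")
    case True
    then have "w \<in> gball E W (Suc 0) v" using that by auto
    from gball_trans[OF this] have "u \<notin> gball E W n w" using Suc.prems(3) by auto
    then show ?thesis using Suc that by simp
  qed simp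
  then show ?case by (auto intro: sum.neutral)
qed

section \<open>Closed walks and the quadratic form\<close>

definition adj_form :: "('a \<Rightarrow> 'a \<Rightarrow> bool) \<Rightarrow> 'a set \<Rightarrow> ('a \<Rightarrow> real) \<Rightarrow> ('a \<Rightarrow> real) \<Rightarrow> real" where
  "adj_form E W x y = (\<Sum>a\<in>W. \<Sum>b\<in>W. of_bool (E a b) * x a * y b)"

lemma adj_form_sym: "symp E \<Longrightarrow> adj_form E W x y = adj_form E W y x"
  unfolding adj_form_def
  by (subst sum.swap) (auto intro!: sum.cong simp: symp_def)

lemma adj_form_add:
  "adj_form E W (\<lambda>v. x v + y v) z = adj_form E W x z + adj_form E W y z"
  "adj_form E W z (\<lambda>v. x v + y v) = adj_form E W z x + adj_form E W z y"
  "adj_form E W (\<lambda>v. x v - y v) z = adj_form E W x z - adj_form E W y z"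
  "adj_form E W z (\<lambda>v. x v - y v) = adj_form E W z x - adj_form E W z y"
  by (simp_all add: adj_form_def algebra_simps sum.distrib sum_subtractf)

lemma adj_form_scale:
  "adj_form E W (\<lambda>v. c * x v) z = c * adj_form E W x z"
  "adj_form E W z (\<lambda>v. c * x v) = c * adj_form E W z x"
  by (simp_all add: adj_form_def sum_distrib_left mult_ac)

text \<open>Nonnegative test vectors are enough for walk counts. They also guarantee that a
  violating vector has positive coordinate sum, which allows two violators to be balanced against
  each other.\<close>

definition nonneg_form_le :: "('a \<Rightarrow> 'a \<Rightarrow> bool) \<Rightarrow> 'a set \<Rightarrow> real \<Rightarrow> 'a set \<Rightarrow> bool" where
  "nonneg_form_le E W \<mu> U \<longleftrightarrow> (\<forall>z. (\<forall>v. 0 \<le> z v) \<longrightarrow> (\<forall>v. v \<notin> U \<longrightarrow> z v = 0) \<longrightarrow>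
     adj_form E W z z \<le> \<mu> * (\<Sum>v\<in>W. (z v)\<^sup>2))"

text \<open>Polarisation: \<open>4 * adj_form E W x y\<close> is the form at \<open>x + y\<close>
  minus the form at \<open>x - y\<close>, and the parallelogram law adds up the two norms.\<close>

lemma adj_form_le:
  assumes "symp E" and le: "nonneg_form_le E W \<mu> U"
    and "\<And>v. 0 \<le> x v" "\<And>v. v \<notin> U \<Longrightarrow> x v = 0" "\<And>v. 0 \<le> y v" "\<And>v. v \<notin> U \<Longrightarrow> y v = 0"
  shows "2 * adj_form E W x y \<le> \<mu> * ((\<Sum>v\<in>W. (x v)\<^sup>2) + (\<Sum>v\<in>W. (y v)\<^sup>2))"
proof -
  have plus: "adj_form E W (\<lambda>v. x v + y v) (\<lambda>v. x v + y v) \<le> \<mu> * (\<Sum>v\<in>W. (x v + y v)\<^sup>2)"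
    using assms(3-6) by (intro le[unfolded nonneg_form_le_def, rule_format]) auto
  \<comment> \<open>The difference may change sign, so the hypothesis is applied to its absolute
    value; this only increases the form because the adjacency entries are nonnegative.\<close>
  have "- adj_form E W (\<lambda>v. x v - y v) (\<lambda>v. x v - y v)
      \<le> adj_form E W (\<lambda>v. \<bar>x v - y v\<bar>) (\<lambda>v. \<bar>x v - y v\<bar>)"
    unfolding adj_form_def sum_negf[symmetric]
  proof (intro sum_mono)
    fix a b
    show "- (of_bool (E a b) * (x a - y a) * (x b - y b)) \<le> of_bool (E a b) * \<bar>x a - y a\<bar> * \<bar>x b - y b\<bar>"
      using abs_ge_minus_self[of "(x a - y a) * (x b - y b)"] by (simp add: abs_mult)
  qed
  also have "\<dots> \<le> \<mu> * (\<Sum>v\<in>W. (\<bar>x v - y v\<bar>)\<^sup>2)"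
    using assms(4,6) by (intro le[unfolded nonneg_form_le_def, rule_format]) auto
  finally have minus: "- adj_form E W (\<lambda>v. x v - y v) (\<lambda>v. x v - y v) \<le> \<mu> * (\<Sum>v\<in>W. (x v - y v)\<^sup>2)"
    by simp
  have sum: "(\<Sum>v\<in>W. (x v + y v)\<^sup>2) + (\<Sum>v\<in>W. (x v - y v)\<^sup>2)
      = 2 * ((\<Sum>v\<in>W. (x v)\<^sup>2) + (\<Sum>v\<in>W. (y v)\<^sup>2))"
  proof -
    have "(\<Sum>v\<in>W. (x v + y v)\<^sup>2) + (\<Sum>v\<in>W. (x v - y v)\<^sup>2) = (\<Sum>v\<in>W. 2 * (x v)\<^sup>2 + 2 * (y v)\<^sup>2)"
      unfolding sum.distrib[symmetric] by (intro sum.cong refl) (simp add: power2_sum power2_diff)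
    then show ?thesis by (simp add: sum.distrib sum_distrib_left)
  qed
  have "\<mu> * (\<Sum>v\<in>W. (x v + y v)\<^sup>2) + \<mu> * (\<Sum>v\<in>W. (x v - y v)\<^sup>2)
     = 2 * (\<mu> * ((\<Sum>v\<in>W. (x v)\<^sup>2) + (\<Sum>v\<in>W. (y v)\<^sup>2)))"
    unfolding distrib_left[symmetric] sum by simp
  with plus minus show ?thesis
    using adj_form_sym[OF assms(1), of W x y] unfolding adj_form_add by linarith
qed

text \<open>The vector \<open>f n\<close> of walk counts from \<open>v\<close> stays inside the ball
  while \<open>n \<le> k\<close>, and one more step multiplies it by the adjacency matrix. The form
  bound lets its norm grow by a factor of at most \<mu> per step, and the closed walks of length
  \<open>2 * k\<close> are the squared norm of \<open>f k\<close>.\<close>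

lemma closed_walks_le:
  assumes "finite W" "symp E" "v \<in> W" "\<mu> > 0" and le: "nonneg_form_le E W \<mu> (gball E W k v)"
  shows "walks E W (2 * k) v v \<le> \<mu> ^ (2 * k)"
proof -
  define f where "f = (\<lambda>n u. if u \<in> W then walks E W n v u else 0)"
  have f0: "f n u \<ge> 0" for n u by (simp add: f_def walks_nonneg)
  have fs: "f n u = 0" if "n \<le> k" "u \<notin> gball E W k v" for n u
    using walks_eq_0[OF assms(3), of u E n] gball_mono[OF that(1), of E W v] that(2) by (auto simp: f_def)
  have "(\<Sum>u\<in>W. (f n u)\<^sup>2) \<le> \<mu> ^ (2 * n)" if "n \<le> k" for n
    using that
  proof (induction n)
    case 0
    have "(\<Sum>u\<in>W. (f 0 u)\<^sup>2) = (\<Sum>u\<in>W. if v = u then 1 else 0)"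
      by (intro sum.cong) (auto simp: f_def)
    then show ?case using assms(1,3) by simp
  next
    case (Suc n)
    define N where "N = (\<Sum>u\<in>W. (f (Suc n) u)\<^sup>2)"
    have step: "f (Suc n) u = (\<Sum>w\<in>W. of_bool (E u w) * f n w)" if "u \<in> W" for u
    proof -
      have "f (Suc n) u = walks E W (Suc n) u v"
        using that walks_sym[OF assms(1,2,3) that, of "Suc n"] by (simp add: f_def)
      also have "\<dots> = (\<Sum>w\<in>W. of_bool (E u w) * f n w)"
        using walks_sym[OF assms(1,2,3), of _ n] by (auto simp: f_def intro!: sum.cong)
      finally show ?thesis .
    qed
    have "adj_form E W (f (Suc n)) (f n) = N"
    proof -
      have "(\<Sum>b\<in>W. of_bool (E a b) * f (Suc n) a * f n b) = (f (Suc n) a)\<^sup>2" if "a \<in> W" for a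
        unfolding power2_eq_square by (subst (3) step[OF that]) (simp add: sum_distrib_left mult_ac)
      then show ?thesis by (simp add: adj_form_def N_def)
    qed
    \<comment> \<open>Scaling by \<open>1 / \<mu>\<close> makes the two squared norms comparable, so
      that the bound on their sum becomes the sharp growth bound.\<close>
    moreover have "2 * adj_form E W (\<lambda>u. (1 / \<mu>) * f (Suc n) u) (f n)
        \<le> \<mu> * ((\<Sum>u\<in>W. ((1 / \<mu>) * f (Suc n) u)\<^sup>2) + (\<Sum>u\<in>W. (f n u)\<^sup>2))"
      using Suc.prems assms(4) by (intro adj_form_le[OF assms(2) le]) (auto simp: f0 fs)
    moreover have "(\<Sum>u\<in>W. ((1 / \<mu>) * f (Suc n) u)\<^sup>2) = N / \<mu>\<^sup>2"
      by (simp add: N_def power_mult_distrib power_divide sum_divide_distrib)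
    ultimately have "2 * N / \<mu> \<le> N / \<mu> + \<mu> * (\<Sum>u\<in>W. (f n u)\<^sup>2)"
      using assms(4) by (simp only: adj_form_scale) (simp add: algebra_simps power2_eq_square)
    then have "N \<le> \<mu>\<^sup>2 * (\<Sum>u\<in>W. (f n u)\<^sup>2)"
      using assms(4) by (simp add: field_simps power2_eq_square)
    also have "\<dots> \<le> \<mu>\<^sup>2 * \<mu> ^ (2 * n)" using Suc by (intro mult_left_mono) auto
    finally show ?case by (simp add: N_def power2_eq_square)
  qed
  from this[of k] have "(\<Sum>u\<in>W. (walks E W k v u)\<^sup>2) \<le> \<mu> ^ (2 * k)" by (simp add: f_def)
  moreover have "walks E W (k + k) v v = (\<Sum>u\<in>W. (walks E W k v u)\<^sup>2)"
    unfolding walks_add[OF assms(1,3)]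
    using walks_sym[OF assms(1,2) _ assms(3), of _ k] by (auto simp: power2_eq_square intro!: sum.cong)
  ultimately show ?thesis by (simp add: mult_2)
qed

text \<open>Two nonnegative vectors violating the bound on separated balls could be combined into a
  vector with coordinate sum zero that violates the global bound.\<close>

lemma card_bad_le:
  fixes \<Delta> \<mu> :: real
  assumes "finite W" "symp E" "\<mu> \<ge> 0" "\<Delta> \<ge> 0"
    and deg: "\<And>v. v \<in> W \<Longrightarrow> real (card {w\<in>W. E v w}) \<le> \<Delta>"
    and form: "\<And>x. adj_form E W x x \<le> \<mu> * (\<Sum>v\<in>W. (x v)\<^sup>2) + (\<Sum>v\<in>W. x v)\<^sup>2 / 2"
  shows "real (card {v\<in>W. \<not> nonneg_form_le E W \<mu> (gball E W k v)}) \<le> (1 + \<Delta>) ^ (2 * k + 1)"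
proof (cases "{v\<in>W. \<not> nonneg_form_le E W \<mu> (gball E W k v)} = {}")
  case True
  then show ?thesis using assms(4) by (simp only: True) simp
next
  case False
  then obtain a where a: "a \<in> W" "\<not> nonneg_form_le E W \<mu> (gball E W k a)" by blast
  have "b \<in> gball E W (2 * k + 1) a"
    if b: "b \<in> W" "\<not> nonneg_form_le E W \<mu> (gball E W k b)" for b
  proof (rule ccontr)
    assume far: "b \<notin> gball E W (2 * k + 1) a"
    obtain x where x: "\<And>v. 0 \<le> x v" "\<And>v. v \<notin> gball E W k a \<Longrightarrow> x v = 0"
      "adj_form E W x x > \<mu> * (\<Sum>v\<in>W. (x v)\<^sup>2)"
      using a(2) unfolding nonneg_form_le_def by (auto simp: not_le)
    obtain y where y: "\<And>v. 0 \<le> y v" "\<And>v. v \<notin> gball E W k b \<Longrightarrow> y v = 0"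
      "adj_form E W y y > \<mu> * (\<Sum>v\<in>W. (y v)\<^sup>2)"
      using b(2) unfolding nonneg_form_le_def by (auto simp: not_le)
    \<comment> \<open>A nonnegative vector with coordinate sum zero vanishes on \<open>W\<close> and
      cannot violate the bound strictly.\<close>
    have sum_pos: "(\<Sum>v\<in>W. z v) > 0" if "\<And>v. 0 \<le> z v" "adj_form E W z z > \<mu> * (\<Sum>v\<in>W. (z v)\<^sup>2)" for z
    proof (rule ccontr)
      assume "\<not> ?thesis"
      then have "(\<Sum>v\<in>W. z v) = 0" using that(1) by (simp add: order_antisym sum_nonneg)
      then have "\<forall>v\<in>W. z v = 0" using that(1) assms(1) by (simp add: sum_nonneg_eq_0_iff)
      then have "adj_form E W z z = 0" by (simp add: adj_form_def)
      with that(2) \<open>\<forall>v\<in>W. z v = 0\<close> show False by simp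
    qed
    \<comment> \<open>A common vertex or an edge between the balls would join \<open>a\<close> to
      \<open>b\<close> in \<open>k + 1 + k\<close> steps.\<close>
    have apart: "u \<noteq> w \<and> \<not> E u w" if "u \<in> gball E W k a" "w \<in> gball E W k b" for u w
    proof (rule ccontr)
      assume "\<not> ?thesis"
      moreover have "w \<in> W" using gball_subset[OF b(1)] that by auto
      ultimately have "w \<in> gball E W (Suc 0) u" by auto
      from gball_trans[OF gball_trans[OF that(1) this] gball_sym[OF assms(2) b(1) that(2)]]
      have "b \<in> gball E W (2 * k + 1) a" by (simp add: mult_2)
      with far show False by simp
    qed
    have xy0: "x u * y u = 0" for u using apart[of u u] x(2) y(2) by auto
    have Exy0: "of_bool (E u w) * x u * y w = 0" for u w using apart[of u w] x(2) y(2) by auto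
    have B0: "adj_form E W x y = 0" "adj_form E W y x = 0"
    proof -
      show "adj_form E W x y = 0" unfolding adj_form_def using Exy0 by (intro sum.neutral ballI) 
      then show "adj_form E W y x = 0" using adj_form_sym[OF assms(2), of W x y] by simp
    qed
    define s where "s = (\<Sum>v\<in>W. x v)"
    define t where "t = (\<Sum>v\<in>W. y v)"
    have pos: "s > 0" "t > 0" using sum_pos[of x] sum_pos[of y] x y by (auto simp: s_def t_def)
    \<comment> \<open>The crossed weights make the coordinate sum vanish, which removes the term
      with the squared sum from \<open>form\<close>.\<close>
    define z where "z = (\<lambda>v. t * x v - s * y v)"
    have z0: "(\<Sum>v\<in>W. z v) = 0"
      by (simp add: z_def sum_subtractf sum_distrib_left[symmetric] s_def t_def)
    have "(z v)\<^sup>2 = t\<^sup>2 * (x v)\<^sup>2 + s\<^sup>2 * (y v)\<^sup>2" for v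
      using xy0[of v] by (auto simp: z_def power2_diff power_mult_distrib)
    then have z2: "(\<Sum>v\<in>W. (z v)\<^sup>2) = t\<^sup>2 * (\<Sum>v\<in>W. (x v)\<^sup>2) + s\<^sup>2 * (\<Sum>v\<in>W. (y v)\<^sup>2)"
      by (simp add: sum.distrib sum_distrib_left)
    have "adj_form E W z z = t\<^sup>2 * adj_form E W x x + s\<^sup>2 * adj_form E W y y"
      unfolding z_def adj_form_add adj_form_scale B0 by (simp add: power2_eq_square)
    also have "\<dots> > t\<^sup>2 * (\<mu> * (\<Sum>v\<in>W. (x v)\<^sup>2)) + s\<^sup>2 * (\<mu> * (\<Sum>v\<in>W. (y v)\<^sup>2))"
      using pos x(3) y(3) by (intro add_strict_mono mult_strict_left_mono) auto
    finally show False using form[of z] z0 z2 by (simp add: algebra_simps)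
  qed
  then have "card {v\<in>W. \<not> nonneg_form_le E W \<mu> (gball E W k v)} \<le> card (gball E W (2 * k + 1) a)"
    using finite_subset[OF gball_subset[OF a(1)] assms(1)] by (intro card_mono) (auto simp del: gball.simps)
  then show ?thesis
    using card_gball[where n = "2 * k + 1", OF assms(1) a(1) deg] by (meson of_nat_le_iff order_trans)
qed

section \<open>Multiplicity of the eigenvalue after deleting vertices\<close>

text \<open>A trace inequality restricted to \<open>V\<close>: the closed walks at \<open>V\<close>
  are the squared entries of the columns in \<open>V\<close> of the \<open>k\<close>-th power, and
  Bessel bounds each row of this block from below. As the eigenvectors live on \<open>V\<close>,
  closed walks at the other vertices of \<open>K\<close> are not counted.\<close>

lemma multiplicity_le_closed_walks:
  fixes y :: "nat \<Rightarrow> 'a \<Rightarrow> real"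
  assumes "finite K" "symp E" "V \<subseteq> K"
    and supp: "\<And>s v. s < t \<Longrightarrow> v \<notin> V \<Longrightarrow> y s v = 0"
    and ortho: "\<And>s s'. s < t \<Longrightarrow> s' < t \<Longrightarrow> (\<Sum>v\<in>V. y s v * y s' v) = of_bool (s = s')"
    and eigen: "\<And>s v. s < t \<Longrightarrow> v \<in> K \<Longrightarrow> (\<Sum>u\<in>K. of_bool (E v u) * y s u) = \<mu> * y s v"
  shows "real t * \<mu> ^ (2 * k) \<le> (\<Sum>v\<in>V. walks E K (2 * k) v v)"
proof -
  have pow: "(\<Sum>u\<in>K. walks E K n v u * y s u) = \<mu> ^ n * y s v" if "s < t" "v \<in> K" for s n v
    using that(2)
  proof (induction n arbitrary: v)
    case 0
    have "(\<Sum>u\<in>K. walks E K 0 v u * y s u) = (\<Sum>u\<in>K. if v = u then y s u else 0)"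
      by (intro sum.cong) auto
    then show ?case using 0 assms(1) by simp
  next
    case (Suc n)
    have "(\<Sum>u\<in>K. walks E K (Suc n) v u * y s u)
        = (\<Sum>u\<in>K. \<Sum>w\<in>K. of_bool (E v w) * (walks E K n w u * y s u))"
      by (simp add: sum_distrib_left sum_distrib_right mult_ac)
    also have "\<dots> = (\<Sum>w\<in>K. of_bool (E v w) * (\<Sum>u\<in>K. walks E K n w u * y s u))"
      by (subst sum.swap) (simp add: sum_distrib_left)
    also have "\<dots> = (\<Sum>w\<in>K. \<mu> ^ n * (of_bool (E v w) * y s w))"
      by (intro sum.cong refl) (simp add: Suc.IH)
    also have "\<dots> = \<mu> ^ Suc n * y s v"
      using eigen[OF that(1) Suc.prems] by (simp add: sum_distrib_left[symmetric])
    finally show ?case .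
  qed
  have finV: "finite V" using assms(1,3) by (rule finite_subset[rotated])
  have row: "(\<Sum>s<t. \<mu> ^ (2 * k) * (y s u)\<^sup>2) \<le> (\<Sum>v\<in>V. (walks E K k u v)\<^sup>2)" if "u \<in> K" for u
  proof -
    have "(\<Sum>v\<in>V. walks E K k u v * y s v) = \<mu> ^ k * y s u" if "s < t" for s
    proof -
      have "(\<Sum>v\<in>V. walks E K k u v * y s v) = (\<Sum>v\<in>K. walks E K k u v * y s v)"
        using assms(1,3) supp[OF that] by (intro sum.mono_neutral_left) auto
      then show ?thesis using pow[OF that \<open>u \<in> K\<close>] by simp
    qed
    then have "(\<Sum>s<t. \<mu> ^ (2 * k) * (y s u)\<^sup>2) = (\<Sum>s<t. (\<Sum>v\<in>V. walks E K k u v * y s v)\<^sup>2)"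
      by (intro sum.cong) (auto simp: power_mult_distrib power_mult[symmetric] mult.commute)
    also have "\<dots> \<le> (\<Sum>v\<in>V. (walks E K k u v)\<^sup>2)" using ortho by (rule bessel[OF finV])
    finally show ?thesis .
  qed
  have unit: "(\<Sum>u\<in>K. (y s u)\<^sup>2) = 1" if "s < t" for s
  proof -
    have "(\<Sum>u\<in>K. (y s u)\<^sup>2) = (\<Sum>u\<in>V. (y s u)\<^sup>2)"
      using assms(1,3) supp[OF that] by (intro sum.mono_neutral_right) auto
    also have "\<dots> = 1" using ortho[OF that that] by (simp add: power2_eq_square)
    finally show ?thesis .
  qed
  have "real t * \<mu> ^ (2 * k) = (\<Sum>s<t. \<mu> ^ (2 * k) * (\<Sum>u\<in>K. (y s u)\<^sup>2))"
    by (simp add: unit)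
  also have "\<dots> = (\<Sum>u\<in>K. \<Sum>s<t. \<mu> ^ (2 * k) * (y s u)\<^sup>2)"
    by (subst sum.swap) (simp add: sum_distrib_left)
  also have "\<dots> \<le> (\<Sum>u\<in>K. \<Sum>v\<in>V. (walks E K k u v)\<^sup>2)"
    by (intro sum_mono row)
  also have "\<dots> = (\<Sum>v\<in>V. \<Sum>u\<in>K. (walks E K k u v)\<^sup>2)" by (rule sum.swap)
  also have "\<dots> = (\<Sum>v\<in>V. walks E K (k + k) v v)"
  proof (rule sum.cong[OF refl])
    fix v assume "v \<in> V"
    then have "v \<in> K" using assms(3) by auto
    then show "(\<Sum>u\<in>K. (walks E K k u v)\<^sup>2) = walks E K (k + k) v v"
      unfolding walks_add[OF assms(1) \<open>v \<in> K\<close>]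
      using walks_sym[OF assms(1,2) _ \<open>v \<in> K\<close>, of _ k]
      by (auto simp: power2_eq_square intro!: sum.cong)
  qed
  finally show ?thesis by (simp add: mult_2)
qed

text \<open>For \<open>K \<subseteq> W\<close>, the probability that exactly \<open>K\<close>
  remains when each vertex of \<open>W\<close> is kept independently with probability
  \<theta>.\<close>

definition keep_weight :: "real \<Rightarrow> 'a set \<Rightarrow> 'a set \<Rightarrow> real" where
  "keep_weight \<theta> W K = \<theta> ^ card K * (1 - \<theta>) ^ card (W - K)"

text \<open>The probability that all of \<open>U\<close> survives. It comes from expanding a product
  over \<open>W\<close> in which the deletion weight of each vertex of \<open>U\<close> is replaced
  by zero, so that only sets containing \<open>U\<close> contribute.\<close>

lemma sum_keep_weight:
  assumes "finite W" "U \<subseteq> W"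
  shows "(\<Sum>K | U \<subseteq> K \<and> K \<subseteq> W. keep_weight \<theta> W K) = \<theta> ^ card U"
proof -
  have "(\<Prod>v\<in>W. \<theta> + (if v \<in> U then 0 else 1 - \<theta>))
      = (\<Sum>K\<in>Pow W. (\<Prod>v\<in>K. \<theta>) * (\<Prod>v\<in>W - K. if v \<in> U then 0 else 1 - \<theta>))"
    by (rule prod_add[OF assms(1)])
  also have "\<dots> = (\<Sum>K\<in>Pow W. if U \<subseteq> K then keep_weight \<theta> W K else 0)"
  proof (rule sum.cong[OF refl])
    fix K assume K: "K \<in> Pow W"
    show "(\<Prod>v\<in>K. \<theta>) * (\<Prod>v\<in>W - K. if v \<in> U then 0 else 1 - \<theta>)
       = (if U \<subseteq> K then keep_weight \<theta> W K else 0)"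
    proof (cases "U \<subseteq> K")
      case True
      then have "(\<Prod>v\<in>W - K. if v \<in> U then 0 else 1 - \<theta>) = (\<Prod>v\<in>W - K. 1 - \<theta>)"
        by (intro prod.cong) auto
      then show ?thesis using True by (simp add: keep_weight_def)
    next
      case False
      then obtain u where "u \<in> U" "u \<notin> K" by auto
      then have "(\<Prod>v\<in>W - K. if v \<in> U then 0 else 1 - \<theta>) = 0"
        using assms by (intro prod_zero) auto
      then show ?thesis using False by simp
    qed
  qed
  also have "\<dots> = (\<Sum>K | U \<subseteq> K \<and> K \<subseteq> W. keep_weight \<theta> W K)"
    using assms(1) by (subst sum.inter_filter[symmetric]) (auto intro!: sum.cong)
  finally have "(\<Sum>K | U \<subseteq> K \<and> K \<subseteq> W. keep_weight \<theta> W K)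
      = (\<Prod>v\<in>W. \<theta> + (if v \<in> U then 0 else 1 - \<theta>))" by simp
  also have "\<dots> = (\<Prod>v\<in>W. if v \<in> U then \<theta> else 1)" by (intro prod.cong) auto
  also have "\<dots> = (\<Prod>v\<in>U. \<theta>)"
    using assms by (subst prod.inter_restrict[symmetric]) (auto simp: Int_absorb1)
  finally show ?thesis by simp
qed

text \<open>A walk that visits at least \<open>S\<close> distinct vertices survives with probability at most \<open>\<theta> ^ S\<close>;
  the walks that visit fewer vertices are counted by recording, at each step, whether the next
  vertex is one of those already visited or a new neighbour.\<close>

lemma expected_walks_le:
  fixes \<Delta> \<theta> :: real
  assumes "finite W" "0 \<le> \<theta>" "\<theta> \<le> 1" "1 \<le> \<Delta>"
    and deg: "\<And>v. v \<in> W \<Longrightarrow> real (card {w\<in>W. E v w}) \<le> \<Delta>"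
    and "U \<subseteq> W" "v \<in> W"
  shows "(\<Sum>K | U \<subseteq> K \<and> K \<subseteq> W. keep_weight \<theta> W K * walks E K n v u)
    \<le> \<theta> ^ S * walks E W n v u + (real S + 1) ^ n * \<Delta> ^ (S - card U)"
  using assms(6,7)
proof (induction n arbitrary: U v)
  case 0
  \<comment> \<open>For \<open>S \<le> card U\<close> the first term dominates; otherwise the second
    is at least 1.\<close>
  have "\<theta> ^ card U \<le> \<theta> ^ S + \<Delta> ^ (S - card U)"
  proof (cases "S \<le> card U")
    case True
    then have "\<theta> ^ card U \<le> \<theta> ^ S" using assms by (intro power_decreasing) auto
    moreover have "0 \<le> \<Delta> ^ (S - card U)" using assms by simp
    ultimately show ?thesis by linarith
  next
    case False
    have "\<theta> ^ card U \<le> 1" "1 \<le> \<Delta> ^ (S - card U)" "0 \<le> \<theta> ^ S"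
      using assms by (auto intro: power_le_one one_le_power)
    then show ?thesis by linarith
  qed
  moreover have "0 \<le> \<Delta> ^ (S - card U)" using assms by simp
  ultimately show ?case using 0 sum_keep_weight[OF assms(1), of U \<theta>] by auto
next
  case (Suc n)
  define N where "N = {w\<in>W. E v w}"
  define G where "G = (\<lambda>U v. \<Sum>K | U \<subseteq> K \<and> K \<subseteq> W. keep_weight \<theta> W K * walks E K n v u)"
  have finN: "finite N" "N \<subseteq> W" using assms(1) by (auto simp: N_def)
  have finU: "finite U" using Suc.prems assms(1) by (auto intro: finite_subset)
  have walkW: "walks E W (Suc n) v u = (\<Sum>w\<in>N. walks E W n w u)"
  proof -
    have "walks E W (Suc n) v u = (\<Sum>w\<in>W. if E v w then walks E W n w u else 0)"
      by (auto intro!: sum.cong)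
    then show ?thesis by (simp add: N_def sum.inter_filter[OF assms(1)])
  qed
  \<comment> \<open>The first step leads to a neighbour \<open>w\<close> that must be kept as well.
    This condition joins \<open>U\<close>, which thus records the vertices visited so far.\<close>
  have eq: "(\<Sum>K | U \<subseteq> K \<and> K \<subseteq> W. keep_weight \<theta> W K * walks E K (Suc n) v u) = (\<Sum>w\<in>N. G (insert w U) w)"
  proof -
    have "walks E K (Suc n) v u = (\<Sum>w\<in>N. if w \<in> K then walks E K n w u else 0)" if "K \<subseteq> W" for K
    proof -
      have "finite K" using that assms(1) by (rule finite_subset)
      have "walks E K (Suc n) v u = (\<Sum>w\<in>K. if w \<in> N then walks E K n w u else 0)"
        using that by (auto intro!: sum.cong simp: N_def)
      also have "\<dots> = (\<Sum>w\<in>K \<inter> N. walks E K n w u)"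
        using \<open>finite K\<close> by (simp add: sum.inter_restrict)
      also have "\<dots> = (\<Sum>w\<in>N. if w \<in> K then walks E K n w u else 0)"
        using finN by (subst Int_commute) (simp add: sum.inter_restrict)
      finally show ?thesis .
    qed
    then have "(\<Sum>K | U \<subseteq> K \<and> K \<subseteq> W. keep_weight \<theta> W K * walks E K (Suc n) v u)
        = (\<Sum>K | U \<subseteq> K \<and> K \<subseteq> W. \<Sum>w\<in>N. if w \<in> K then keep_weight \<theta> W K * walks E K n w u else 0)"
      by (intro sum.cong refl) (auto simp: sum_distrib_left simp del: walks.simps intro!: sum.cong)
    also have "\<dots> = (\<Sum>w\<in>N. \<Sum>K | U \<subseteq> K \<and> K \<subseteq> W. if w \<in> K then keep_weight \<theta> W K * walks E K n w u else 0)"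
      by (rule sum.swap)
    also have "\<dots> = (\<Sum>w\<in>N. G (insert w U) w)"
    proof (rule sum.cong[OF refl])
      fix w
      have "finite {K. U \<subseteq> K \<and> K \<subseteq> W}" using assms(1) by simp
      then have "(\<Sum>K | U \<subseteq> K \<and> K \<subseteq> W. if w \<in> K then keep_weight \<theta> W K * walks E K n w u else 0)
        = (\<Sum>K\<in>{K\<in>{K. U \<subseteq> K \<and> K \<subseteq> W}. w \<in> K}. keep_weight \<theta> W K * walks E K n w u)"
        by (simp only: sum.inter_filter)
      also have "{K\<in>{K. U \<subseteq> K \<and> K \<subseteq> W}. w \<in> K} = {K. insert w U \<subseteq> K \<and> K \<subseteq> W}" by auto
      finally show "(\<Sum>K | U \<subseteq> K \<and> K \<subseteq> W. if w \<in> K then keep_weight \<theta> W K * walks E K n w u else 0)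
        = G (insert w U) w" by (simp add: G_def)
    qed
    finally show ?thesis .
  qed
  have IH: "G (insert w U) w \<le> \<theta> ^ S * walks E W n w u + (real S + 1) ^ n * \<Delta> ^ (S - card (insert w U))"
    if "w \<in> N" for w
    unfolding G_def using that finN Suc.prems by (intro Suc.IH) auto
  show ?case
  proof (cases "S \<le> card U")
    \<comment> \<open>With \<open>S\<close> vertices already visited, the survival of
      \<open>U\<close> alone costs \<theta>^S, and the rest of the walk may be counted in all of
      \<open>W\<close>.\<close>
    case True
    have kw: "keep_weight \<theta> W K \<ge> 0" for K
      unfolding keep_weight_def using assms by simp
    have mono: "walks E K m a b \<le> walks E W m a b" if "K \<subseteq> W" for K m a b
    proof (induction m arbitrary: a)
      case 0
      then show ?case by simp
    next
      case (Suc m)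
      have "walks E K (Suc m) a b \<le> (\<Sum>w\<in>K. of_bool (E a w) * walks E W m w b)"
        using Suc by (auto intro!: sum_mono)
      also have "\<dots> \<le> (\<Sum>w\<in>W. of_bool (E a w) * walks E W m w b)"
        using that assms(1) by (intro sum_mono2) (auto simp: walks_nonneg)
      finally show ?case by simp
    qed
    have "(\<Sum>K | U \<subseteq> K \<and> K \<subseteq> W. keep_weight \<theta> W K * walks E K (Suc n) v u)
        \<le> (\<Sum>K | U \<subseteq> K \<and> K \<subseteq> W. keep_weight \<theta> W K * walks E W (Suc n) v u)"
      by (intro sum_mono mult_left_mono mono kw) auto
    also have "\<dots> = \<theta> ^ card U * walks E W (Suc n) v u"
      using sum_keep_weight[OF assms(1) Suc.prems(1), of \<theta>] by (simp add: sum_distrib_right[symmetric] del: walks.simps)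
    also have "\<dots> \<le> \<theta> ^ S * walks E W (Suc n) v u"
      using True assms by (intro mult_right_mono power_decreasing walks_nonneg) auto
    finally show ?thesis
      by (rule order_trans) (use assms in \<open>simp del: walks.simps\<close>)
  next
    case False
    define c where "c = (real S + 1) ^ n * \<Delta> ^ (S - card U)"
    have c0: "c \<ge> 0" using assms by (simp add: c_def)
    \<comment> \<open>Returning to \<open>U\<close> leaves the exponent alone and costs
      \<open>c\<close>; a new vertex lowers the exponent by one and costs
      \<open>c / \<Delta>\<close>. Fewer than \<open>S\<close> choices of the first kind and at most
      \<Delta> of the second give the factor \<open>S + 1\<close>.\<close>
    have "(\<Sum>w\<in>N. (real S + 1) ^ n * \<Delta> ^ (S - card (insert w U)))
        \<le> (\<Sum>w\<in>N. c * of_bool (w \<in> U) + c / \<Delta>)"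
    proof (rule sum_mono)
      fix w
      show "(real S + 1) ^ n * \<Delta> ^ (S - card (insert w U)) \<le> c * of_bool (w \<in> U) + c / \<Delta>"
      proof (cases "w \<in> U")
        case True
        then show ?thesis using c0 assms by (simp add: insert_absorb c_def)
      next
        case w: False
        have "\<Delta> ^ (S - card U) = \<Delta> * \<Delta> ^ (S - Suc (card U))"
          using False by (metis Suc_diff_Suc not_le power_Suc)
        then show ?thesis using w finU assms by (simp add: c_def)
      qed
    qed
    also have "\<dots> = c * real (card (N \<inter> U)) + real (card N) * (c / \<Delta>)"
    proof -
      have "(\<Sum>w\<in>N. of_bool (w \<in> U) :: real) = real (card (N \<inter> U))"
        using finN(1) by (simp add: of_bool_def flip: sum.inter_restrict)
      then show ?thesis by (simp add: sum.distrib sum_distrib_left[symmetric])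
    qed
    also have "\<dots> \<le> c * real S + \<Delta> * (c / \<Delta>)"
    proof (intro add_mono mult_left_mono mult_right_mono)
      have "card (N \<inter> U) \<le> card U" using finU by (intro card_mono) auto
      then show "real (card (N \<inter> U)) \<le> real S" using False by simp
      show "real (card N) \<le> \<Delta>" using deg Suc.prems by (simp add: N_def)
    qed (use c0 assms in auto)
    also have "\<dots> = (real S + 1) ^ Suc n * \<Delta> ^ (S - card U)"
      using assms by (simp add: c_def algebra_simps)
    finally have "(\<Sum>w\<in>N. (real S + 1) ^ n * \<Delta> ^ (S - card (insert w U))) \<le> \<dots>" .
    moreover have "(\<Sum>w\<in>N. G (insert w U) w)
        \<le> (\<Sum>w\<in>N. \<theta> ^ S * walks E W n w u) + (\<Sum>w\<in>N. (real S + 1) ^ n * \<Delta> ^ (S - card (insert w U)))"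
      unfolding sum.distrib[symmetric] by (intro sum_mono IH)
    ultimately show ?thesis
      unfolding eq walkW by (simp add: sum_distrib_left)
  qed
qed

text \<open>Averaging over the kept set \<open>K\<close>. Solutions of the system \<open>c\<close>
  supported on \<open>K - B\<close> are \<mu>-eigenvectors of the graph induced on \<open>K\<close>,
  and there are at least \<open>card K - card I - card B\<close> independent ones; the closed walks
  at \<open>K - B\<close> bound their number. In expectation \<open>card K\<close> becomes
  \<open>\<theta> * card W\<close>, and the walks are controlled by \<open>expected_walks_le\<close>
  and, outside the bad set \<open>B\<close>, by \<open>closed_walks_le\<close>.\<close>

lemma card_le_of_deletion:
  fixes \<Delta> \<theta> \<mu> :: real and c :: "'i \<Rightarrow> 'a \<Rightarrow> real"
  assumes "finite W" "symp E" "\<mu> > 0" "1 \<le> \<Delta>" "0 \<le> \<theta>" "\<theta> \<le> 1" "finite I"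
    and deg: "\<And>v. v \<in> W \<Longrightarrow> real (card {w\<in>W. E v w}) \<le> \<Delta>"
    and form: "\<And>x. adj_form E W x x \<le> \<mu> * (\<Sum>v\<in>W. (x v)\<^sup>2) + (\<Sum>v\<in>W. x v)\<^sup>2 / 2"
    and eigen: "\<And>x v. \<forall>i\<in>I. (\<Sum>v\<in>W. c i v * x v) = 0 \<Longrightarrow> v \<in> W \<Longrightarrow>
      (\<Sum>u\<in>W. of_bool (E v u) * x u) = \<mu> * x v"
  shows "real (card W) * (\<theta> - \<theta> ^ S - (real S + 1) ^ (2 * k) * \<Delta> ^ (S - 1) / \<mu> ^ (2 * k))
    \<le> real (card I) + (1 + \<Delta>) ^ (2 * k + 1)"
proof -
  define B where "B = {v\<in>W. \<not> nonneg_form_le E W \<mu> (gball E W k v)}"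
  define b where "b = real (card I) + real (card B)"
  have finB: "finite B" using assms(1) by (simp add: B_def)
  have b_le: "b \<le> real (card I) + (1 + \<Delta>) ^ (2 * k + 1)"
    using card_bad_le[OF assms(1,2) _ _ deg form] assms(3,4) by (simp add: b_def B_def)
  have kw: "keep_weight \<theta> W K \<ge> 0" for K
    unfolding keep_weight_def using assms by simp
  have each: "(real (card K) - b) * \<mu> ^ (2 * k)
      \<le> (\<Sum>v\<in>W - B. if v \<in> K then walks E K (2 * k) v v else 0)" if "K \<subseteq> W" for K
  proof -
    have finK: "finite K" using that assms(1) by (rule finite_subset)
    \<comment> \<open>Truncated subtraction: if \<open>K - B\<close> is too small then
      \<open>t = 0\<close> and the trace bound is trivial.\<close>
    define t where "t = card (K - B) - card I"
    have "real (card K) - b \<le> real t"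
      using diff_card_le_card_Diff[OF finB, of K] by (simp add: b_def t_def)
    then have "(real (card K) - b) * \<mu> ^ (2 * k) \<le> real t * \<mu> ^ (2 * k)"
      using assms(3) by (intro mult_right_mono) auto
    also have "\<dots> \<le> (\<Sum>v\<in>K - B. walks E K (2 * k) v v)"
    proof (cases "t = 0")
      case True
      then show ?thesis by (simp add: sum_nonneg walks_nonneg)
    next
      case False
      then have "card I + t \<le> card (K - B)" by (simp add: t_def)
      from orthonormal_solutions[OF assms(7) _ this, of c] finK obtain y :: "nat \<Rightarrow> 'a \<Rightarrow> real"
        where y: "\<forall>s<t. (\<forall>v. v \<notin> K - B \<longrightarrow> y s v = 0) \<and>
          (\<forall>i\<in>I. (\<Sum>v\<in>K - B. c i v * y s v) = 0) \<and>
          (\<forall>s'<t. (\<Sum>v\<in>K - B. y s v * y s' v) = of_bool (s = s'))" by auto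
      show ?thesis
      proof (rule multiplicity_le_closed_walks[OF finK assms(2), of _ _ y])
        fix s v assume "s < t" "v \<in> K"
        \<comment> \<open>Vanishing off \<open>K - B\<close> is what turns sums over
          \<open>W\<close> into sums over \<open>K\<close>, so the eigenvalue equation passes to the
          induced subgraph.\<close>
        have supp: "\<And>u. u \<notin> K - B \<Longrightarrow> y s u = 0" using y \<open>s < t\<close> by blast
        have "(\<Sum>u\<in>W. c i u * y s u) = 0" if "i \<in> I" for i
        proof -
          have "(\<Sum>u\<in>W. c i u * y s u) = (\<Sum>u\<in>K - B. c i u * y s u)"
            using \<open>K \<subseteq> W\<close> assms(1) supp by (intro sum.mono_neutral_right) auto
          then show ?thesis using y \<open>s < t\<close> that by simp
        qed
        then have "(\<Sum>u\<in>W. of_bool (E v u) * y s u) = \<mu> * y s v"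
          using \<open>v \<in> K\<close> \<open>K \<subseteq> W\<close> by (intro eigen) auto
        moreover have "(\<Sum>u\<in>W. of_bool (E v u) * y s u) = (\<Sum>u\<in>K. of_bool (E v u) * y s u)"
          using \<open>K \<subseteq> W\<close> assms(1) supp by (intro sum.mono_neutral_right) auto
        ultimately show "(\<Sum>u\<in>K. of_bool (E v u) * y s u) = \<mu> * y s v" by simp
      qed (use y in auto)
    qed
    also have "\<dots> = (\<Sum>v\<in>(W - B) \<inter> K. walks E K (2 * k) v v)"
      using that by (intro sum.cong) auto
    also have "\<dots> = (\<Sum>v\<in>W - B. if v \<in> K then walks E K (2 * k) v v else 0)"
      using assms(1) by (intro sum.inter_restrict) auto
    finally show ?thesis .
  qed
  have restrict: "(\<Sum>K\<in>Pow W. if v \<in> K then g K else 0) = (\<Sum>K | {v} \<subseteq> K \<and> K \<subseteq> W. g K)"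
    for v :: 'a and g :: "'a set \<Rightarrow> real"
  proof -
    have "(\<Sum>K\<in>Pow W. if v \<in> K then g K else 0) = (\<Sum>K\<in>{K\<in>Pow W. v \<in> K}. g K)"
      using assms(1) by (intro sum.inter_filter[symmetric]) simp
    also have "{K\<in>Pow W. v \<in> K} = {K. {v} \<subseteq> K \<and> K \<subseteq> W}" by auto
    finally show ?thesis .
  qed
  have total: "(\<Sum>K\<in>Pow W. keep_weight \<theta> W K) = 1"
    using sum_keep_weight[OF assms(1), of "{}" \<theta>] by (simp add: Pow_def)
  have size: "(\<Sum>K\<in>Pow W. keep_weight \<theta> W K * real (card K)) = \<theta> * real (card W)"
  proof -
    have "(\<Sum>K\<in>Pow W. keep_weight \<theta> W K * real (card K))
        = (\<Sum>K\<in>Pow W. \<Sum>v\<in>W. if v \<in> K then keep_weight \<theta> W K else 0)"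
    proof (rule sum.cong[OF refl])
      fix K assume "K \<in> Pow W"
      then have "W \<inter> K = K" by auto
      then show "keep_weight \<theta> W K * real (card K) = (\<Sum>v\<in>W. if v \<in> K then keep_weight \<theta> W K else 0)"
        using assms(1) by (simp add: sum.inter_restrict[symmetric])
    qed
    also have "\<dots> = (\<Sum>v\<in>W. \<Sum>K\<in>Pow W. if v \<in> K then keep_weight \<theta> W K else 0)" by (rule sum.swap)
    also have "\<dots> = (\<Sum>v\<in>W. \<theta>)"
      unfolding restrict using sum_keep_weight[OF assms(1), of "{v}" \<theta> for v] by (intro sum.cong) auto
    finally show ?thesis by simp
  qed
  \<comment> \<open>The exponent is \<open>S - 1\<close> because the starting vertex already counts
    as visited: \<open>U = {v}\<close>.\<close>
  define M where "M = (real S + 1) ^ (2 * k) * \<Delta> ^ (S - 1)"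
  have M0: "M \<ge> 0" using assms by (simp add: M_def)
  have "(\<theta> * real (card W) - b) * \<mu> ^ (2 * k)
      = (\<Sum>K\<in>Pow W. keep_weight \<theta> W K * ((real (card K) - b) * \<mu> ^ (2 * k)))"
  proof -
    have "(\<Sum>K\<in>Pow W. keep_weight \<theta> W K * ((real (card K) - b) * \<mu> ^ (2 * k)))
      = (\<Sum>K\<in>Pow W. (keep_weight \<theta> W K * real (card K) - keep_weight \<theta> W K * b) * \<mu> ^ (2 * k))"
      by (intro sum.cong refl) (simp add: algebra_simps)
    then show ?thesis
      by (simp add: sum_subtractf sum_distrib_right[symmetric] total size)
  qed
  also have "\<dots> \<le> (\<Sum>K\<in>Pow W. keep_weight \<theta> W K *
      (\<Sum>v\<in>W - B. if v \<in> K then walks E K (2 * k) v v else 0))"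
    by (intro sum_mono mult_left_mono each kw) auto
  also have "\<dots> = (\<Sum>K\<in>Pow W. \<Sum>v\<in>W - B. if v \<in> K then keep_weight \<theta> W K * walks E K (2 * k) v v else 0)"
    by (auto simp: sum_distrib_left intro!: sum.cong)
  also have "\<dots> = (\<Sum>v\<in>W - B. \<Sum>K\<in>Pow W. if v \<in> K then keep_weight \<theta> W K * walks E K (2 * k) v v else 0)"
    by (rule sum.swap)
  also have "\<dots> \<le> (\<Sum>v\<in>W - B. \<theta> ^ S * \<mu> ^ (2 * k) + M)"
  proof (rule sum_mono)
    fix v assume v: "v \<in> W - B"
    have "walks E W (2 * k) v v \<le> \<mu> ^ (2 * k)"
      using v by (intro closed_walks_le assms) (auto simp: B_def)
    then have "\<theta> ^ S * walks E W (2 * k) v v \<le> \<theta> ^ S * \<mu> ^ (2 * k)"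
      using assms(5) by (intro mult_left_mono) auto
    with expected_walks_le[where E = E and U = "{v}" and v = v and n = "2 * k" and u = v and S = S,
        OF assms(1,5,6,4) deg] v
    show "(\<Sum>K\<in>Pow W. if v \<in> K then keep_weight \<theta> W K * walks E K (2 * k) v v else 0)
      \<le> \<theta> ^ S * \<mu> ^ (2 * k) + M"
      unfolding restrict by (simp add: M_def)
  qed
  also have "\<dots> = real (card (W - B)) * (\<theta> ^ S * \<mu> ^ (2 * k) + M)" by simp
  also have "\<dots> \<le> real (card W) * (\<theta> ^ S * \<mu> ^ (2 * k) + M)"
    using assms M0 by (intro mult_right_mono) (auto intro!: card_mono)
  finally have "(\<theta> * real (card W) - b) * \<mu> ^ (2 * k) \<le> real (card W) * (\<theta> ^ S * \<mu> ^ (2 * k) + M)" .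
  then have "(\<theta> * real (card W) - b) \<le> real (card W) * (\<theta> ^ S * \<mu> ^ (2 * k) + M) / \<mu> ^ (2 * k)"
    using assms(3) by (simp add: pos_le_divide_eq)
  also have "\<dots> = real (card W) * (\<theta> ^ S + M / \<mu> ^ (2 * k))"
    using assms(3) by (simp add: field_simps)
  finally have "real (card W) * (\<theta> - \<theta> ^ S - M / \<mu> ^ (2 * k)) \<le> b" by (simp add: algebra_simps)
  with b_le show ?thesis by (simp add: M_def)
qed

section \<open>Gram matrices of equiangular systems\<close>

text \<open>Vectors are functions on \<open>nat\<close> whose first \<open>r\<close> coordinates
  count, so sign changes and linear combinations need no dimension conditions.\<close>

definition inner_upto :: "nat \<Rightarrow> (nat \<Rightarrow> real) \<Rightarrow> (nat \<Rightarrow> real) \<Rightarrow> real" where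
  "inner_upto r x y = (\<Sum>p<r. x p * y p)"

lemma sum_square_gram:
  fixes a :: "'a \<Rightarrow> 'b \<Rightarrow> real"
  shows "(\<Sum>i\<in>I. (\<Sum>v\<in>W. a v i)\<^sup>2) = (\<Sum>u\<in>W. \<Sum>v\<in>W. \<Sum>i\<in>I. a u i * a v i)"
proof -
  have "(\<Sum>i\<in>I. (\<Sum>v\<in>W. a v i)\<^sup>2) = (\<Sum>i\<in>I. \<Sum>u\<in>W. \<Sum>v\<in>W. a u i * a v i)"
    by (simp add: power2_eq_square sum_product)
  also have "\<dots> = (\<Sum>u\<in>W. \<Sum>v\<in>W. \<Sum>i\<in>I. a u i * a v i)"
    by (subst sum.swap) (intro sum.cong refl sum.swap)
  finally show ?thesis .
qed

definition switched_gram :: "real \<Rightarrow> nat \<Rightarrow> ('a \<Rightarrow> 'a \<Rightarrow> bool) \<Rightarrow> 'a set \<Rightarrow> ('a \<Rightarrow> nat \<Rightarrow> real) \<Rightarrow> bool" where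
  "switched_gram \<alpha> r E W Y \<longleftrightarrow> (\<forall>u\<in>W. \<forall>v\<in>W.
     inner_upto r (Y u) (Y v) = (1 - \<alpha>) * of_bool (u = v) + \<alpha> - 2 * \<alpha> * of_bool (E u v))"

lemma switched_gram_subset: "switched_gram \<alpha> r E V Y \<Longrightarrow> W \<subseteq> V \<Longrightarrow> switched_gram \<alpha> r E W Y"
  unfolding switched_gram_def by blast

lemma switched_gram_row:
  assumes "finite W" "switched_gram \<alpha> r E W Y" "v \<in> W"
  shows "(\<Sum>u\<in>W. inner_upto r (Y v) (Y u) * x u)
    = (1 - \<alpha>) * x v + \<alpha> * (\<Sum>u\<in>W. x u) - 2 * \<alpha> * (\<Sum>u\<in>W. of_bool (E v u) * x u)"
proof -
  have "(\<Sum>u\<in>W. inner_upto r (Y v) (Y u) * x u)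
     = (\<Sum>u\<in>W. (if v = u then (1 - \<alpha>) * x u else 0) + \<alpha> * x u - 2 * \<alpha> * (of_bool (E v u) * x u))"
  proof (rule sum.cong[OF refl])
    fix u assume "u \<in> W"
    with assms(2,3) have *: "inner_upto r (Y v) (Y u) = (1 - \<alpha>) * of_bool (v = u) + \<alpha> - 2 * \<alpha> * of_bool (E v u)"
      by (simp add: switched_gram_def)
    show "inner_upto r (Y v) (Y u) * x u
      = (if v = u then (1 - \<alpha>) * x u else 0) + \<alpha> * x u - 2 * \<alpha> * (of_bool (E v u) * x u)"
      unfolding * by (cases "v = u"; cases "E v u") (simp_all add: algebra_simps)
  qed
  then show ?thesis
    using assms(1,3) by (simp add: sum.distrib sum_subtractf sum_distrib_left[symmetric])
qed

text \<open>The squared norm of the combination of the \<open>Y v\<close> with coefficients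
  \<open>x v\<close> is nonnegative; expanding it and dividing by \<open>2 * \<alpha>\<close> leaves
  half the squared coordinate sum from the all-ones matrix.\<close>

lemma switched_gram_form:
  assumes "finite W" "switched_gram \<alpha> r E W Y" "\<alpha> > 0"
  shows "adj_form E W x x \<le> (1 - \<alpha>) / (2 * \<alpha>) * (\<Sum>v\<in>W. (x v)\<^sup>2) + (\<Sum>v\<in>W. x v)\<^sup>2 / 2"
proof -
  have "0 \<le> (\<Sum>p<r. (\<Sum>v\<in>W. x v * Y v p)\<^sup>2)" by (intro sum_nonneg) auto
  also have "\<dots> = (\<Sum>v\<in>W. \<Sum>u\<in>W. \<Sum>p<r. (x v * Y v p) * (x u * Y u p))"
    by (rule sum_square_gram)
  also have "\<dots> = (\<Sum>v\<in>W. x v * (\<Sum>u\<in>W. inner_upto r (Y v) (Y u) * x u))"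
    by (simp add: inner_upto_def sum_distrib_left sum_distrib_right mult_ac)
  also have "\<dots> = (\<Sum>v\<in>W. (1 - \<alpha>) * (x v)\<^sup>2 + \<alpha> * (\<Sum>u\<in>W. x u) * x v
      - 2 * \<alpha> * (\<Sum>u\<in>W. of_bool (E v u) * x v * x u))"
  proof (rule sum.cong[OF refl])
    fix v assume "v \<in> W"
    have "(\<Sum>u\<in>W. of_bool (E v u) * x v * x u) = x v * (\<Sum>u\<in>W. of_bool (E v u) * x u)"
      by (simp add: sum_distrib_left mult_ac)
    then show "x v * (\<Sum>u\<in>W. inner_upto r (Y v) (Y u) * x u)
      = (1 - \<alpha>) * (x v)\<^sup>2 + \<alpha> * (\<Sum>u\<in>W. x u) * x v - 2 * \<alpha> * (\<Sum>u\<in>W. of_bool (E v u) * x v * x u)"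
      unfolding switched_gram_row[OF assms(1,2) \<open>v \<in> W\<close>] by (simp add: algebra_simps power2_eq_square)
  qed
  also have "\<dots> = (1 - \<alpha>) * (\<Sum>v\<in>W. (x v)\<^sup>2) + \<alpha> * (\<Sum>u\<in>W. x u)\<^sup>2 - 2 * \<alpha> * adj_form E W x x"
    by (simp add: sum.distrib sum_subtractf sum_distrib_left[symmetric] adj_form_def power2_eq_square)
  finally show ?thesis using assms(3) by (simp add: field_simps)
qed

text \<open>On the kernel of the Gram matrix with coordinate sum zero, only the identity and the
  adjacency matrix remain in the Gram decomposition. Membership is expressed by \<open>r + 1\<close>
  linear equations.\<close>

lemma switched_gram_eigen:
  assumes "finite W" "switched_gram \<alpha> r E W Y" "\<alpha> > 0" "v \<in> W"
    and ker: "\<forall>p<r. (\<Sum>u\<in>W. Y u p * x u) = 0" and "(\<Sum>u\<in>W. x u) = 0"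
  shows "(\<Sum>u\<in>W. of_bool (E v u) * x u) = (1 - \<alpha>) / (2 * \<alpha>) * x v"
proof -
  have "(\<Sum>u\<in>W. inner_upto r (Y v) (Y u) * x u) = (\<Sum>u\<in>W. \<Sum>p<r. Y v p * (Y u p * x u))"
    by (simp add: inner_upto_def sum_distrib_left sum_distrib_right mult_ac)
  also have "\<dots> = (\<Sum>p<r. Y v p * (\<Sum>u\<in>W. Y u p * x u))"
    by (subst sum.swap) (simp add: sum_distrib_left)
  also have "\<dots> = 0" using ker by simp
  finally show ?thesis
    using switched_gram_row[OF assms(1,2,4), of x] assms(3,6) by (simp add: field_simps)
qed

text \<open>Testing the sum of the tensors \<open>s v *\<^sub>R (Y v \<otimes> Y v)\<close> against \<open>e \<otimes> f\<close>: the tensors have equal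
  pairwise inner products \<open>\<alpha>\<^sup>2\<close>, which cancel because the signs are balanced.\<close>

lemma balanced_signs_bound:
  fixes s :: "'a \<Rightarrow> real"
  assumes "finite M" and sgn: "\<And>v. v \<in> M \<Longrightarrow> s v * s v = 1" and bal: "(\<Sum>v\<in>M. s v) = 0"
    and gram: "\<And>u v. u \<in> M \<Longrightarrow> v \<in> M \<Longrightarrow>
      (inner_upto r (Y u) (Y v))\<^sup>2 = (1 - \<alpha>\<^sup>2) * of_bool (u = v) + \<alpha>\<^sup>2"
    and "inner_upto r e e = 1" "inner_upto r f f = 1"
    and e: "\<And>v. v \<in> M \<Longrightarrow> inner_upto r e (Y v) = \<alpha>"
    and f: "\<And>v. v \<in> M \<Longrightarrow> inner_upto r f (Y v) = s v * \<alpha>"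
  shows "real (card M) * \<alpha> ^ 4 \<le> 1"
proof (cases "M = {}")
  case True
  then show ?thesis by simp
next
  case False
  define I where "I = {..<r} \<times> {..<r}"
  define c where "c = \<alpha>\<^sup>2 * real (card M)"
  have tensor: "(\<Sum>i\<in>I. (x (fst i) * y (snd i)) * (z (fst i) * w (snd i)))
      = inner_upto r x z * inner_upto r y w" for x y z w :: "nat \<Rightarrow> real"
    unfolding I_def inner_upto_def sum_product sum.cartesian_product
    by (intro sum.cong) (auto simp: mult_ac)
  \<comment> \<open>The signed sum of tensor squares, with tensors stored as functions on index
    pairs.\<close>
  define Z where "Z = (\<lambda>i. \<Sum>v\<in>M. s v * (Y v (fst i) * Y v (snd i)))"
  have ZZ: "(\<Sum>i\<in>I. (Z i)\<^sup>2) = (1 - \<alpha>\<^sup>2) * real (card M)"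
  proof -
    have "(\<Sum>i\<in>I. (Z i)\<^sup>2) = (\<Sum>u\<in>M. \<Sum>v\<in>M. \<Sum>i\<in>I. (s u * (Y u (fst i) * Y u (snd i))) *
        (s v * (Y v (fst i) * Y v (snd i))))"
      unfolding Z_def by (rule sum_square_gram)
    also have "\<dots> = (\<Sum>u\<in>M. \<Sum>v\<in>M. s u * s v * (inner_upto r (Y u) (Y v))\<^sup>2)"
    proof (intro sum.cong refl)
      fix u v
      have "(\<Sum>i\<in>I. (s u * (Y u (fst i) * Y u (snd i))) * (s v * (Y v (fst i) * Y v (snd i))))
        = s u * s v * (\<Sum>i\<in>I. (Y u (fst i) * Y u (snd i)) * (Y v (fst i) * Y v (snd i)))"
        by (simp add: sum_distrib_left mult_ac)
      then show "(\<Sum>i\<in>I. (s u * (Y u (fst i) * Y u (snd i))) * (s v * (Y v (fst i) * Y v (snd i))))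
        = s u * s v * (inner_upto r (Y u) (Y v))\<^sup>2" by (simp add: tensor power2_eq_square)
    qed
    also have "\<dots> = (\<Sum>u\<in>M. \<Sum>v\<in>M. (if u = v then 1 - \<alpha>\<^sup>2 else 0) + \<alpha>\<^sup>2 * (s u * s v))"
      using sgn by (intro sum.cong refl) (simp add: gram algebra_simps)
    also have "\<dots> = (1 - \<alpha>\<^sup>2) * real (card M)"
      using assms(1) bal by (simp add: sum.distrib sum_distrib_left[symmetric])
    finally show ?thesis .
  qed
  have Zef: "(\<Sum>i\<in>I. Z i * (e (fst i) * f (snd i))) = c"
  proof -
    have "(\<Sum>i\<in>I. Z i * (e (fst i) * f (snd i)))
      = (\<Sum>i\<in>I. \<Sum>v\<in>M. s v * ((e (fst i) * f (snd i)) * (Y v (fst i) * Y v (snd i))))"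
      by (simp add: Z_def sum_distrib_right sum_distrib_left mult_ac)
    also have "\<dots> = (\<Sum>v\<in>M. s v * (inner_upto r e (Y v) * inner_upto r f (Y v)))"
      by (subst sum.swap) (simp add: sum_distrib_left[symmetric] tensor)
    also have "\<dots> = (\<Sum>v\<in>M. \<alpha>\<^sup>2)"
    proof (rule sum.cong[OF refl])
      fix v assume "v \<in> M"
      then have "s v * (inner_upto r e (Y v) * inner_upto r f (Y v)) = (s v * s v) * \<alpha>\<^sup>2"
        by (simp add: e f power2_eq_square)
      then show "s v * (inner_upto r e (Y v) * inner_upto r f (Y v)) = \<alpha>\<^sup>2"
        using sgn[OF \<open>v \<in> M\<close>] by simp
    qed
    finally show ?thesis by (simp add: c_def)
  qed
  have ef: "(\<Sum>i\<in>I. (e (fst i) * f (snd i))\<^sup>2) = 1"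
    using tensor[of e f e f] assms(5,6) by (simp add: power2_eq_square)
  \<comment> \<open>Cauchy-Schwarz against the unit tensor of \<open>e\<close> and \<open>f\<close>:
    \<open>c\<close> is the coefficient of the projection of \<open>Z\<close>.\<close>
  have "0 \<le> (\<Sum>i\<in>I. (Z i - c * (e (fst i) * f (snd i)))\<^sup>2)" by (intro sum_nonneg) auto
  also have "\<dots> = (\<Sum>i\<in>I. (Z i)\<^sup>2 - 2 * c * (Z i * (e (fst i) * f (snd i)))
      + c\<^sup>2 * (e (fst i) * f (snd i))\<^sup>2)"
    by (intro sum.cong refl) (simp add: power2_diff power_mult_distrib)
  also have "\<dots> = (1 - \<alpha>\<^sup>2) * real (card M) - 2 * c * c + c\<^sup>2"
    by (simp only: sum.distrib sum_subtractf sum_distrib_left[symmetric] ZZ Zef ef mult_1_right)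
  finally have "c\<^sup>2 \<le> (1 - \<alpha>\<^sup>2) * real (card M)" by (simp add: power2_eq_square)
  also have "\<dots> \<le> 1 * real (card M)" by (intro mult_right_mono) auto
  finally have "real (card M) * (real (card M) * \<alpha> ^ 4) \<le> real (card M) * 1"
    by (simp add: c_def power2_eq_square power4_eq_xxxx mult_ac)
  then show ?thesis
    using False assms(1) by (simp add: mult_le_cancel_left_pos card_gt_0_iff)
qed

text \<open>If both sets were large, equally large parts of them would carry balanced signs. With
  \<open>f = Y b\<close> those signs are exactly the signs of the inner products with
  \<open>Y b\<close>, so \<open>balanced_signs_bound\<close> is violated.\<close>

lemma degree_dichotomy:
  assumes "finite V" "switched_gram \<alpha> r E V Y" "symp E" "\<And>v. \<not> E v v" "0 < \<alpha>" "b \<in> V"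
    and "inner_upto r e e = 1" and e: "\<And>v. v \<in> V \<Longrightarrow> inner_upto r e (Y v) = \<alpha>"
  shows "real (card {v\<in>V. E b v}) \<le> 1 / \<alpha> ^ 4 \<or> real (card {v\<in>V. v \<noteq> b \<and> \<not> E b v}) \<le> 1 / \<alpha> ^ 4"
proof (rule ccontr)
  define N where "N = {v\<in>V. E b v}"
  define P where "P = {v\<in>V. v \<noteq> b \<and> \<not> E b v}"
  define m where "m = min (card N) (card P)"
  assume "\<not> ?thesis"
  then have m: "real m > 1 / \<alpha> ^ 4" by (simp add: m_def N_def P_def min_def)
  have "m \<le> card N" "m \<le> card P" by (simp_all add: m_def)
  then obtain N' P' where N': "N' \<subseteq> N" "card N' = m" "finite N'" and P': "P' \<subseteq> P" "card P' = m" "finite P'"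
    by (metis obtain_subset_with_card_n)
  have disj: "N' \<inter> P' = {}" using N'(1) P'(1) by (auto simp: N_def P_def)
  have sub: "N' \<union> P' \<subseteq> V - {b}" using N'(1) P'(1) assms(4) by (auto simp: N_def P_def)
  define s where "s = (\<lambda>v. if v \<in> N' then -1 else 1 :: real)"
  have gram: "inner_upto r (Y u) (Y v) = (1 - \<alpha>) * of_bool (u = v) + \<alpha> - 2 * \<alpha> * of_bool (E u v)"
    if "u \<in> V" "v \<in> V" for u v using that assms(2) by (simp add: switched_gram_def)
  have "real (card (N' \<union> P')) * \<alpha> ^ 4 \<le> 1"
  proof (rule balanced_signs_bound[of _ s r Y \<alpha> e "Y b"])
    show "finite (N' \<union> P')" using N' P' by simp
    show "s v * s v = 1" for v by (simp add: s_def)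
    have "(\<Sum>v\<in>N' \<union> P'. s v) = (\<Sum>v\<in>N'. -1) + (\<Sum>v\<in>P'. 1)"
    proof -
      have "(\<Sum>v\<in>N' \<union> P'. s v) = (\<Sum>v\<in>N'. s v) + (\<Sum>v\<in>P'. s v)"
        using disj N' P' by (intro sum.union_disjoint)
      moreover have "(\<Sum>v\<in>P'. s v) = (\<Sum>v\<in>P'. 1)"
        using disj by (intro sum.cong) (auto simp: s_def)
      ultimately show ?thesis by (simp add: s_def)
    qed
    then show "(\<Sum>v\<in>N' \<union> P'. s v) = 0" using N' P' by simp
    show "inner_upto r (Y b) (Y b) = 1" using gram[of b b] assms(4,6) by simp
    show "inner_upto r e e = 1" by fact
    show "(inner_upto r (Y u) (Y v))\<^sup>2 = (1 - \<alpha>\<^sup>2) * of_bool (u = v) + \<alpha>\<^sup>2"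
      if "u \<in> N' \<union> P'" "v \<in> N' \<union> P'" for u v
    proof -
      have "u \<in> V" "v \<in> V" using that sub by auto
      then show ?thesis using gram[of u v] assms(4) by (cases "u = v"; cases "E u v") auto
    qed
    show "inner_upto r e (Y v) = \<alpha>" if "v \<in> N' \<union> P'" for v using that sub e by blast
    show "inner_upto r (Y b) (Y v) = s v * \<alpha>" if "v \<in> N' \<union> P'" for v
    proof -
      have "E b v \<longleftrightarrow> v \<in> N'" using that N'(1) P'(1) by (auto simp: N_def P_def)
      moreover have "v \<in> V" "b \<noteq> v" using that sub by auto
      ultimately show ?thesis using gram[OF assms(6), of v] by (simp add: s_def)
    qed
  qed
  then have "2 * (real m * \<alpha> ^ 4) \<le> 1"
    using N' P' disj by (simp add: card_Un_disjoint)
  moreover have "real m * \<alpha> ^ 4 > 1" using m assms(5) by (simp add: field_simps)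
  ultimately show False by simp
qed

text \<open>Vertices with few non-neighbours span a dense subgraph, which the form bound forbids to be large.\<close>

lemma card_high_degree_le:
  fixes \<mu> \<Delta> :: real
  assumes "finite V" "0 \<le> \<mu>" "0 \<le> \<Delta>"
    and few: "\<And>b. b \<in> V \<Longrightarrow> real (card {v\<in>V. v \<noteq> b \<and> \<not> E b v}) \<le> \<Delta>"
    and form: "adj_form E V (\<lambda>_. 1) (\<lambda>_. 1) \<le> \<mu> * real (card V) + (real (card V))\<^sup>2 / 2"
  shows "real (card V) \<le> 2 * (\<mu> + \<Delta> + 1)"
proof (cases "V = {}")
  case True
  then show ?thesis using assms by simp
next
  case False
  define n where "n = real (card V)"
  have "n > 0" using False assms(1) by (simp add: n_def card_gt_0_iff)
  have "n - 1 - \<Delta> \<le> (\<Sum>v\<in>V. of_bool (E b v))" if "b \<in> V" for b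
  proof -
    have "V \<subseteq> {v\<in>V. E b v} \<union> ({v\<in>V. v \<noteq> b \<and> \<not> E b v} \<union> {b})" by auto
    then have "card V \<le> card ({v\<in>V. E b v} \<union> ({v\<in>V. v \<noteq> b \<and> \<not> E b v} \<union> {b}))"
      using assms(1) by (intro card_mono) auto
    also have "\<dots> \<le> card {v\<in>V. E b v} + (card {v\<in>V. v \<noteq> b \<and> \<not> E b v} + card {b})"
      by (meson add_left_mono card_Un_le order_trans)
    finally have "n \<le> real (card {v\<in>V. E b v}) + (real (card {v\<in>V. v \<noteq> b \<and> \<not> E b v}) + 1)"
      by (simp add: n_def)
    moreover have "(\<Sum>v\<in>V. of_bool (E b v)) = real (card {v\<in>V. E b v})"
      using assms(1) by (simp add: of_bool_def sum.inter_filter[symmetric])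
    ultimately show ?thesis using few[OF that] by simp
  qed
  then have "(\<Sum>b\<in>V. n - 1 - \<Delta>) \<le> adj_form E V (\<lambda>_. 1) (\<lambda>_. 1)"
    unfolding adj_form_def by (intro sum_mono) simp
  then have "n * (n - 1 - \<Delta>) \<le> n * (\<mu> + n / 2)"
    using form by (simp add: n_def algebra_simps power2_eq_square)
  then have "n - 1 - \<Delta> \<le> \<mu> + n / 2" using \<open>n > 0\<close> by (simp add: mult_le_cancel_left_pos)
  then show ?thesis by (simp add: n_def)
qed


section \<open>Upper bound for equiangular systems of unit vectors\<close>

lemma inner_upto_commute: "inner_upto r x y = inner_upto r y x"
  by (simp add: inner_upto_def mult.commute)

text \<open>The three summands account for the fixed vector \<open>a\<close>, the vertices
  \<open>N\<close> of degree above \<Delta>, and the rest \<open>W\<close>, to which the deletion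
  argument applies.\<close>

lemma equiangular_vectors_bound:
  fixes X :: "'a \<Rightarrow> nat \<Rightarrow> real"
  defines "\<mu> \<equiv> \<lambda>\<alpha>. (1 - \<alpha>) / (2 * \<alpha>)"
  assumes "finite V" "0 < \<alpha>" "\<alpha> < 1" "0 \<le> \<theta>" "\<theta> \<le> 1" "0 < \<gamma>"
    and unit: "\<And>v. v \<in> V \<Longrightarrow> inner_upto r (X v) (X v) = 1"
    and angle: "\<And>u v. u \<in> V \<Longrightarrow> v \<in> V \<Longrightarrow> u \<noteq> v \<Longrightarrow> \<bar>inner_upto r (X u) (X v)\<bar> = \<alpha>"
    and \<gamma>: "\<gamma> \<le> \<theta> - \<theta> ^ S - (real S + 1) ^ (2 * k) * (1 / \<alpha> ^ 4) ^ (S - 1) / \<mu> \<alpha> ^ (2 * k)"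
  shows "real (card V) \<le> 1 + 2 * (\<mu> \<alpha> + 1 / \<alpha> ^ 4 + 1) + (real r + 1 + (1 + 1 / \<alpha> ^ 4) ^ (2 * k + 1)) / \<gamma>"
proof (cases "V = {}")
  case True
  then show ?thesis using assms by simp
next
  case False
  then obtain a where a: "a \<in> V" by blast
  define \<Delta> where "\<Delta> = 1 / \<alpha> ^ 4"
  have \<mu>: "\<mu> \<alpha> > 0" using assms(3,4) by (simp add: \<mu>_def)
  have \<Delta>: "\<Delta> \<ge> 1" using assms(3,4) by (simp add: \<Delta>_def power_le_one)
  define V' where "V' = V - {a}"
  \<comment> \<open>Switching with respect to \<open>a\<close>: afterwards every vector has inner
    product \<alpha> with \<open>X a\<close>, while absolute values are unchanged.\<close>
  define Y where "Y = (\<lambda>v. if inner_upto r (X a) (X v) < 0 then (\<lambda>p. - X v p) else X v)"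
  define E where "E = (\<lambda>u v. u \<noteq> v \<and> inner_upto r (Y u) (Y v) < 0)"
  have sym: "symp E" by (auto simp: symp_def E_def inner_upto_commute)
  have irr: "\<not> E v v" for v by (simp add: E_def)
  have flip: "inner_upto r (\<lambda>p. - x p) y = - inner_upto r x y"
    "inner_upto r x (\<lambda>p. - y p) = - inner_upto r x y" for x y
    by (simp_all add: inner_upto_def sum_negf)
  have Ya: "inner_upto r (X a) (Y v) = \<alpha>" if "v \<in> V'" for v
    using angle[of a v] a that by (auto simp: Y_def V'_def flip split: if_splits)
  have Y1: "inner_upto r (Y v) (Y v) = 1" if "v \<in> V'" for v
    using unit[of v] that by (simp add: Y_def V'_def flip)
  have Yuv: "\<bar>inner_upto r (Y u) (Y v)\<bar> = \<alpha>" if "u \<in> V'" "v \<in> V'" "u \<noteq> v" for u v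
    using angle[of u v] that by (simp add: Y_def V'_def flip)
  have gram: "switched_gram \<alpha> r E V' Y"
    unfolding switched_gram_def
  proof (intro ballI)
    fix u v assume uv: "u \<in> V'" "v \<in> V'"
    show "inner_upto r (Y u) (Y v) = (1 - \<alpha>) * of_bool (u = v) + \<alpha> - 2 * \<alpha> * of_bool (E u v)"
    proof (cases "u = v")
      case True
      then show ?thesis using Y1[of v] uv irr by simp
    next
      case False
      then show ?thesis using Yuv[OF uv False] by (auto simp: E_def abs_if split: if_splits)
    qed
  qed
  have finV': "finite V'" using assms(2) by (simp add: V'_def)
  define N where "N = {b\<in>V'. real (card {v\<in>V'. E b v}) > \<Delta>}"
  define W where "W = V' - N"
  have finN: "finite N" "N \<subseteq> V'" and finW: "finite W" "W \<subseteq> V'" using finV' by (auto simp: N_def W_def)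
  have gramN: "switched_gram \<alpha> r E N Y" and gramW: "switched_gram \<alpha> r E W Y"
    using switched_gram_subset[OF gram] finN finW by auto
  have "real (card N) \<le> 2 * (\<mu> \<alpha> + \<Delta> + 1)"
  proof (rule card_high_degree_le[OF finN(1)])
    fix b assume b: "b \<in> N"
    \<comment> \<open>Membership in \<open>N\<close> excludes the first alternative of the
      dichotomy.\<close>
    have "real (card {v\<in>V'. v \<noteq> b \<and> \<not> E b v}) \<le> \<Delta>"
      using degree_dichotomy[OF finV' gram sym irr assms(3) _ unit[OF a] Ya, of b] b
      by (auto simp: N_def \<Delta>_def)
    moreover have "card {v\<in>N. v \<noteq> b \<and> \<not> E b v} \<le> card {v\<in>V'. v \<noteq> b \<and> \<not> E b v}"
      using finN finV' by (intro card_mono) auto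
    ultimately show "real (card {v\<in>N. v \<noteq> b \<and> \<not> E b v}) \<le> \<Delta>" by linarith
  next
    show "adj_form E N (\<lambda>_. 1) (\<lambda>_. 1) \<le> \<mu> \<alpha> * real (card N) + (real (card N))\<^sup>2 / 2"
      using switched_gram_form[OF finN(1) gramN assms(3), of "\<lambda>_. 1"] by (simp add: \<mu>_def)
  qed (use \<mu> \<Delta> in auto)
  moreover have "real (card W) \<le> (real r + 1 + (1 + \<Delta>) ^ (2 * k + 1)) / \<gamma>"
  proof -
    \<comment> \<open>Index \<open>p < r\<close> is the equation for coordinate \<open>p\<close>,
      index \<open>r\<close> the vanishing coordinate sum; hence \<open>r + 1\<close>
      equations.\<close>
    have "real (card W) * (\<theta> - \<theta> ^ S - (real S + 1) ^ (2 * k) * \<Delta> ^ (S - 1) / \<mu> \<alpha> ^ (2 * k))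
      \<le> real (card {..r}) + (1 + \<Delta>) ^ (2 * k + 1)"
    proof (rule card_le_of_deletion[OF finW(1) sym \<mu> \<Delta> assms(5,6),
          where c = "\<lambda>p v. if p < r then Y v p else 1"])
      fix v assume v: "v \<in> W"
      have "card {w\<in>W. E v w} \<le> card {w\<in>V'. E v w}"
        using finW finV' by (intro card_mono) auto
      then show "real (card {w\<in>W. E v w}) \<le> \<Delta>" using v by (auto simp: W_def N_def)
    next
      fix x
      show "adj_form E W x x \<le> \<mu> \<alpha> * (\<Sum>v\<in>W. (x v)\<^sup>2) + (\<Sum>v\<in>W. x v)\<^sup>2 / 2"
        using switched_gram_form[OF finW(1) gramW assms(3)] by (simp add: \<mu>_def)
    next
      fix x v
      assume ker: "\<forall>i\<in>{..r}. (\<Sum>v\<in>W. (if i < r then Y v i else 1) * x v) = 0" and v: "v \<in> W"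
      have "(\<Sum>u\<in>W. Y u p * x u) = 0" if "p < r" for p
        using ker[rule_format, of p] that by simp
      moreover have "(\<Sum>u\<in>W. x u) = 0" using ker[rule_format, of r] by simp
      ultimately show "(\<Sum>u\<in>W. of_bool (E v u) * x u) = \<mu> \<alpha> * x v"
        using switched_gram_eigen[OF finW(1) gramW assms(3) v, of x] by (simp add: \<mu>_def)
    qed auto
    then have "real (card W) * \<gamma> \<le> real r + 1 + (1 + \<Delta>) ^ (2 * k + 1)"
      using mult_left_mono[OF \<gamma>, of "real (card W)"] by (simp add: \<Delta>_def)
    then show ?thesis using assms(7) by (simp add: pos_le_divide_eq)
  qed
  moreover have "card V = 1 + (card N + card W)"
  proof -
    have "card V' = card N + card W"
      using finN finV' card_mono[OF finV' finN(2)] by (simp add: W_def card_Diff_subset)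
    then show ?thesis using a assms(2) card_Suc_Diff1[of V a] by (simp add: V'_def)
  qed
  ultimately show ?thesis by (simp add: \<Delta>_def)
qed

text \<open>Here \<theta> is \<open>1 - d\<close> and \<open>k\<close> is \<open>2 * S\<close>, with
  \<open>S\<close> depending only on \<open>d\<close>. Up to constants the last term compares the
  power \<open>4 * (S - 1)\<close> of \<open>1 / \<alpha>\<close> with the power
  \<open>4 * S\<close>, so it tends to zero with \<alpha>.\<close>

lemma deletion_parameters:
  fixes d :: real
  assumes "0 < d" "d < 1"
  shows "\<exists>S A0. \<forall>\<alpha>. 0 < \<alpha> \<longrightarrow> A0 \<le> 1 / \<alpha> \<longrightarrow>
    1 - 3 * d \<le> (1 - d) - (1 - d) ^ S
      - (real S + 1) ^ (2 * (2 * S)) * (1 / \<alpha> ^ 4) ^ (S - 1) / ((1 - \<alpha>) / (2 * \<alpha>)) ^ (2 * (2 * S))"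
proof -
  obtain n where "(1 - d) ^ n < d"
    using real_arch_pow_inv[of d "1 - d"] assms by auto
  \<comment> \<open>One more factor ensures \<open>S \<ge> 1\<close>, so that \<open>S - 1\<close>
    is a genuine subtraction.\<close>
  then have "(1 - d) ^ Suc n \<le> d"
    using assms by (smt (verit) mult_left_le_one_le power_Suc zero_le_power)
  then obtain S where S: "S \<ge> 1" "(1 - d) ^ S \<le> d" by (intro that[of "Suc n"]) auto
  define Q where "Q = (4 * (real S + 1)) ^ (4 * S)"
  have Q: "Q > 0" by (simp add: Q_def)
  show ?thesis
  proof (intro exI[of _ S] exI[of _ "max 2 (Q / d)"] allI impI)
    fix \<alpha> :: real
    assume "0 < \<alpha>" and big: "max 2 (Q / d) \<le> 1 / \<alpha>"
    define A where "A = 1 / \<alpha>"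
    have A: "A \<ge> 2" "A \<ge> Q / d" and \<alpha>: "\<alpha> = 1 / A" using big by (auto simp: A_def)
    have pow: "(1 / \<alpha> ^ 4) ^ (S - 1) = A ^ (4 * (S - 1))"
      using A by (simp add: \<alpha> power_divide power_mult)
    \<comment> \<open>The left side of the comparison is safe because the eigenvalue equals
      \<open>(A - 1) / 2\<close> and \<open>A \<ge> 2\<close>.\<close>
    have "A / 4 \<le> (1 - \<alpha>) / (2 * \<alpha>)" using A by (simp add: \<alpha> field_simps)
    then have "(A / 4) ^ (4 * S) \<le> ((1 - \<alpha>) / (2 * \<alpha>)) ^ (4 * S)"
      using A by (intro power_mono) auto
    then have "(real S + 1) ^ (4 * S) * (1 / \<alpha> ^ 4) ^ (S - 1) / ((1 - \<alpha>) / (2 * \<alpha>)) ^ (4 * S)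
        \<le> (real S + 1) ^ (4 * S) * (1 / \<alpha> ^ 4) ^ (S - 1) / (A / 4) ^ (4 * S)"
      using A by (intro divide_left_mono) (auto simp: \<alpha> intro!: mult_pos_pos)
    also note pow
    also have "(real S + 1) ^ (4 * S) * A ^ (4 * (S - 1)) / (A / 4) ^ (4 * S) = Q / A ^ 4"
    proof -
      have "A ^ (4 * S) = A ^ (4 * (S - 1)) * A ^ 4"
        using S(1) by (simp flip: power_add) (simp add: algebra_simps)
      moreover have "Q = 4 ^ (4 * S) * (real S + 1) ^ (4 * S)"
        unfolding Q_def by (rule power_mult_distrib)
      ultimately show ?thesis using A by (simp add: power_divide field_simps)
    qed
    also have "\<dots> \<le> Q / A"
      using A Q self_le_power[of A 4] by (intro divide_left_mono) auto
    also have "\<dots> \<le> d" using A assms Q by (simp add: field_simps)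
    finally have "(real S + 1) ^ (4 * S) * (1 / \<alpha> ^ 4) ^ (S - 1) / ((1 - \<alpha>) / (2 * \<alpha>)) ^ (4 * S) \<le> d"
      by (simp only: pow)
    then show "1 - 3 * d \<le> (1 - d) - (1 - d) ^ S
      - (real S + 1) ^ (2 * (2 * S)) * (1 / \<alpha> ^ 4) ^ (S - 1) / ((1 - \<alpha>) / (2 * \<alpha>)) ^ (2 * (2 * S))"
      using S(2) by simp
  qed
qed

text \<open>With the deletion parameters fixed in terms of \<epsilon> alone, every contribution
  other than the one linear in \<open>r\<close> is polynomial in \<open>1 / \<alpha>\<close>,
  uniformly in \<open>r\<close>.\<close>

lemma equiangular_vectors_card_le:
  fixes \<epsilon> :: real
  assumes "0 < \<epsilon>" "\<epsilon> \<le> 1"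
  shows "\<exists>C M A0. \<forall>\<alpha> r V (X :: 'a \<Rightarrow> nat \<Rightarrow> real). 0 < \<alpha> \<longrightarrow> A0 \<le> 1 / \<alpha> \<longrightarrow> finite V \<longrightarrow>
    (\<forall>v\<in>V. inner_upto r (X v) (X v) = 1) \<longrightarrow>
    (\<forall>u\<in>V. \<forall>v\<in>V. u \<noteq> v \<longrightarrow> \<bar>inner_upto r (X u) (X v)\<bar> = \<alpha>) \<longrightarrow>
    real (card V) \<le> (1 + \<epsilon>) * real r + C * (1 / \<alpha>) ^ M"
proof -
  \<comment> \<open>Then \<open>1 - 3 * d\<close> is \<open>1 - \<epsilon> / 4\<close>, whose
    inverse is at most \<open>1 + \<epsilon>\<close> for \<open>\<epsilon> \<le> 1\<close>.\<close>
  define d where "d = \<epsilon> / 12"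
  have d: "0 < d" "d < 1" "0 < 1 - 3 * d" using assms by (auto simp: d_def)
  have inv: "1 / (1 - 3 * d) \<le> 1 + \<epsilon>"
  proof -
    have "\<epsilon> * \<epsilon> \<le> \<epsilon> * 1" using assms by (intro mult_left_mono) auto
    then have "1 \<le> (1 + \<epsilon>) * (1 - 3 * d)" using assms by (simp add: d_def algebra_simps)
    then show ?thesis using d by (simp add: pos_divide_le_eq)
  qed
  obtain S A0 where SA: "\<And>\<alpha>. 0 < \<alpha> \<Longrightarrow> A0 \<le> 1 / \<alpha> \<Longrightarrow>
    1 - 3 * d \<le> (1 - d) - (1 - d) ^ S
      - (real S + 1) ^ (2 * (2 * S)) * (1 / \<alpha> ^ 4) ^ (S - 1) / ((1 - \<alpha>) / (2 * \<alpha>)) ^ (2 * (2 * S))"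
    using deletion_parameters[OF d(1,2)] by blast
  define m where "m = 2 * (2 * S) + 1"
  \<comment> \<open>The lower-order terms \<open>3 + 2 * A + 2 * A ^ 4\<close> give 7; the term with
    factor \<open>1 + \<epsilon> \<le> 2\<close> gives \<open>2 + 2 * 2 ^ m\<close>.\<close>
  define C :: real where "C = 9 + 2 * 2 ^ m"
  show ?thesis
  proof (rule exI[of _ C], rule exI[of _ "4 * m"], rule exI[of _ "max 2 A0"], intro allI impI)
    fix \<alpha> :: real and r :: nat and V :: "'a set" and X :: "'a \<Rightarrow> nat \<Rightarrow> real"
    assume \<alpha>0: "0 < \<alpha>" and big: "max 2 A0 \<le> 1 / \<alpha>" and V: "finite V"
      and unit: "\<forall>v\<in>V. inner_upto r (X v) (X v) = 1"
      and angle: "\<forall>u\<in>V. \<forall>v\<in>V. u \<noteq> v \<longrightarrow> \<bar>inner_upto r (X u) (X v)\<bar> = \<alpha>"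
    define A where "A = 1 / \<alpha>"
    have A: "A \<ge> 2" "A0 \<le> A" and \<alpha>: "\<alpha> = 1 / A" using big by (auto simp: A_def)
    have "\<alpha> < 1" using A by (simp add: \<alpha>)
    have A4: "1 / \<alpha> ^ 4 = A ^ 4" by (simp add: \<alpha> power_divide)
    have "real (card V) \<le> 1 + 2 * ((1 - \<alpha>) / (2 * \<alpha>) + 1 / \<alpha> ^ 4 + 1)
      + (real r + 1 + (1 + 1 / \<alpha> ^ 4) ^ m) / (1 - 3 * d)"
      unfolding m_def
    proof (rule equiangular_vectors_bound[OF V \<alpha>0 \<open>\<alpha> < 1\<close>, of "1 - d" "1 - 3 * d" r X S])
      show "1 - 3 * d \<le> (1 - d) - (1 - d) ^ S
        - (real S + 1) ^ (2 * (2 * S)) * (1 / \<alpha> ^ 4) ^ (S - 1) / ((1 - \<alpha>) / (2 * \<alpha>)) ^ (2 * (2 * S))"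
        using big by (intro SA[OF \<alpha>0]) simp
    qed (use unit angle d in auto)
    moreover have "(1 - \<alpha>) / (2 * \<alpha>) \<le> A" using A by (simp add: \<alpha> field_simps)
    moreover have "(real r + 1 + (1 + A ^ 4) ^ m) / (1 - 3 * d) \<le> (1 + \<epsilon>) * (real r + 1 + (1 + A ^ 4) ^ m)"
    proof -
      have "0 \<le> real r + 1 + (1 + A ^ 4) ^ m" using A by (intro add_nonneg_nonneg) auto
      from mult_right_mono[OF inv this] show ?thesis by simp
    qed
    ultimately have "real (card V) \<le> 1 + 2 * (A + A ^ 4 + 1) + (1 + \<epsilon>) * (real r + 1 + (1 + A ^ 4) ^ m)"
      unfolding A4 by (meson add_left_mono add_mono add_right_mono mult_left_mono order_trans zero_le_numeral)
    moreover have "A \<le> A ^ (4 * m)" "A ^ 4 \<le> A ^ (4 * m)" "1 \<le> A ^ (4 * m)"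
      using A self_le_power[of A "4 * m"] power_increasing[of 4 "4 * m" A] by (auto simp: m_def)
    moreover have "(1 + \<epsilon>) * (1 + (1 + A ^ 4) ^ m) \<le> 2 * (A ^ (4 * m) + 2 ^ m * A ^ (4 * m))"
    proof -
      have "(1 + A ^ 4) ^ m \<le> (2 * A ^ 4) ^ m"
        using A by (intro power_mono) (auto simp: one_le_power)
      also have "\<dots> = 2 ^ m * A ^ (4 * m)" by (simp add: power_mult_distrib power_mult)
      finally have "1 + (1 + A ^ 4) ^ m \<le> A ^ (4 * m) + 2 ^ m * A ^ (4 * m)"
        using \<open>1 \<le> A ^ (4 * m)\<close> by linarith
      then show ?thesis using A assms by (intro mult_mono) auto
    qed
    ultimately have "real (card V) \<le> (1 + \<epsilon>) * real r + (9 + 2 * 2 ^ m) * A ^ (4 * m)"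
      by (simp add: algebra_simps)
    then show "real (card V) \<le> (1 + \<epsilon>) * real r + C * (1 / \<alpha>) ^ (4 * m)"
      by (simp add: C_def A_def)
  qed
qed

section \<open>Equiangular lines\<close>

lemma scalar_prod_eq_inner_upto:
  "v \<in> carrier_vec r \<Longrightarrow> scalar_prod u v = inner_upto r (vec_index u) (vec_index v)"
  by (simp add: scalar_prod_def inner_upto_def lessThan_atLeast0)

lemma inner_upto_unit_le:
  assumes "inner_upto r x x = 1" "inner_upto r y y = 1"
  shows "\<bar>inner_upto r x y\<bar> \<le> 1"
proof -
  have "0 \<le> (\<Sum>p<r. (x p - y p)\<^sup>2)" "0 \<le> (\<Sum>p<r. (x p + y p)\<^sup>2)" by (simp_all add: sum_nonneg)
  moreover have "(\<Sum>p<r. (x p - y p)\<^sup>2) = inner_upto r x x + inner_upto r y y - 2 * inner_upto r x y"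
    "(\<Sum>p<r. (x p + y p)\<^sup>2) = inner_upto r x x + inner_upto r y y + 2 * inner_upto r x y"
    by (simp_all add: inner_upto_def power2_eq_square algebra_simps sum.distrib sum_subtractf
        sum_distrib_left)
  ultimately show ?thesis using assms by simp
qed

lemma line_unit_vector:
  assumes "l \<in> lines_through_origin r"
  shows "\<exists>u\<in>l - {0\<^sub>v r}. u \<in> carrier_vec r \<and> scalar_prod u u = 1"
proof -
  obtain v where v: "l = {c \<cdot>\<^sub>v v | c. True}" "v \<in> carrier_vec r" "v \<noteq> 0\<^sub>v r"
    using assms by (auto simp: lines_through_origin_def)
  have "\<exists>p<r. v $ p \<noteq> 0"
  proof (rule ccontr)
    assume "\<not> ?thesis"
    then have "v = 0\<^sub>v r" using v(2) by (intro eq_vecI) auto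
    with v(3) show False by simp
  qed
  then obtain p where p: "p < r" "v $ p \<noteq> 0" by blast
  have "scalar_prod v v > 0"
    unfolding scalar_prod_def using v(2) p
    by (intro sum_pos2[of _ p]) (auto simp: zero_less_mult_iff not_le)
  define u where "u = (1 / sqrt (scalar_prod v v)) \<cdot>\<^sub>v v"
  have "scalar_prod u u = 1"
    using v(2) \<open>scalar_prod v v > 0\<close> by (simp add: u_def)
  moreover have "u \<in> carrier_vec r" "u \<in> l" using v by (auto simp: u_def)
  moreover have "u \<noteq> 0\<^sub>v r" using \<open>scalar_prod u u = 1\<close> by auto
  ultimately show ?thesis by blast
qed

text \<open>For unit vectors the angle is the arccosine of the absolute inner product, and arccosine
  is injective on [-1, 1].\<close>

lemma equiangular_lines_unit_vectors:
  assumes "equiangular \<alpha> r L" "0 \<le> \<alpha>" "\<alpha> \<le> 1"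
  shows "\<exists>X. (\<forall>l\<in>L. inner_upto r (X l) (X l) = 1) \<and>
    (\<forall>l\<in>L. \<forall>m\<in>L. l \<noteq> m \<longrightarrow> \<bar>inner_upto r (X l) (X m)\<bar> = \<alpha>)"
proof -
  have "\<forall>l\<in>L. \<exists>u. u \<in> l - {0\<^sub>v r} \<and> u \<in> carrier_vec r \<and> scalar_prod u u = 1"
  proof
    fix l assume "l \<in> L"
    then have "l \<in> lines_through_origin r"
      using assms(1)[unfolded equiangular_def, THEN conjunct1] by (rule subsetD[rotated])
    from line_unit_vector[OF this] show "\<exists>u. u \<in> l - {0\<^sub>v r} \<and> u \<in> carrier_vec r \<and> scalar_prod u u = 1"
      by (simp add: Bex_def)
  qed
  from bchoice[OF this] obtain f
    where f: "\<And>l. l \<in> L \<Longrightarrow> f l \<in> l - {0\<^sub>v r} \<and> f l \<in> carrier_vec r \<and> scalar_prod (f l) (f l) = 1"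
    by blast
  define X where "X = (\<lambda>l. vec_index (f l))"
  have ip: "scalar_prod (f l) (f m) = inner_upto r (X l) (X m)" if "m \<in> L" for l m
    using f[OF that] by (simp add: X_def scalar_prod_eq_inner_upto)
  have unit: "inner_upto r (X l) (X l) = 1" if "l \<in> L" for l
    using f[OF that] ip[OF that, of l] by simp
  have "\<bar>inner_upto r (X l) (X m)\<bar> = \<alpha>" if lm: "l \<in> L" "m \<in> L" "l \<noteq> m" for l m
  proof -
    have "acute_angle (f l) (f m) = arccos \<alpha>"
      using f[OF lm(1)] f[OF lm(2)]
      by (intro assms(1)[unfolded equiangular_def, THEN conjunct2, rule_format, OF lm]) simp_all
    then have "arccos \<bar>inner_upto r (X l) (X m)\<bar> = arccos \<alpha>"
      using f[OF lm(1)] f[OF lm(2)] unfolding acute_angle_def euclid_norm_def ip[OF lm(2), symmetric] by simp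
    then show ?thesis
      using inner_upto_unit_le[OF unit[OF lm(1)] unit[OF lm(2)]] assms(2,3)
        arccos_eq_iff[of "\<bar>inner_upto r (X l) (X m)\<bar>" \<alpha>] by simp
  qed
  with unit show ?thesis by (intro exI[of _ X]) simp
qed

text \<open>The Gram matrix \<open>(1 - \<alpha>) I + \<alpha> J\<close> is positive definite; its square root has the form
  \<open>a I + b J\<close>, and the rows of the latter span the lines.\<close>

lemma equiangular_exists:
  assumes "0 < \<alpha>" "\<alpha> < 1" "r > 0"
  shows "\<exists>L. finite L \<and> equiangular \<alpha> r L \<and> card L = r"
proof -
  define a where "a = sqrt (1 - \<alpha>)"
  \<comment> \<open>The root of \<open>2 * a * b + r * b\<^sup>2 = \<alpha>\<close>, which makes the
    rows of \<open>a I + b J\<close> have pairwise inner products \<alpha>.\<close>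
  define b where "b = (sqrt (a\<^sup>2 + real r * \<alpha>) - a) / real r"
  define w where "w = (\<lambda>i. vec r (\<lambda>p. a * of_bool (i = p) + b))"
  define line where "line = (\<lambda>i. {c \<cdot>\<^sub>v w i | c. True})"
  have a2: "a\<^sup>2 = 1 - \<alpha>" using assms by (simp add: a_def)
  have ab: "2 * a * b + real r * b\<^sup>2 = \<alpha>"
  proof -
    have "(real r * b + a)\<^sup>2 = a\<^sup>2 + real r * \<alpha>"
      using assms by (simp add: b_def)
    then have "real r * (2 * a * b + real r * b\<^sup>2) = real r * \<alpha>"
      by (simp add: power2_eq_square algebra_simps)
    then show ?thesis using assms(3) by simp
  qed
  have w: "w i \<in> carrier_vec r" for i by (simp add: w_def)
  have ip: "scalar_prod (w i) (w j) = (if i = j then 1 else \<alpha>)" if "i < r" "j < r" for i j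
  proof -
    have "scalar_prod (w i) (w j) = (\<Sum>p<r. (a * of_bool (i = p) + b) * (a * of_bool (j = p) + b))"
      by (simp add: scalar_prod_def w_def lessThan_atLeast0)
    also have "\<dots> = (\<Sum>p<r. (if i = p then a\<^sup>2 * of_bool (i = j) + a * b else 0)
        + (if j = p then a * b else 0) + b\<^sup>2)"
      by (intro sum.cong refl) (auto simp: algebra_simps power2_eq_square)
    also have "\<dots> = a\<^sup>2 * of_bool (i = j) + (2 * a * b + real r * b\<^sup>2)"
      using that by (simp add: sum.distrib)
    finally show ?thesis unfolding ab a2 by simp
  qed
  have wn0: "w i \<noteq> 0\<^sub>v r" if "i < r" for i using ip[OF that that] by auto
  have lines: "line i \<in> lines_through_origin r" if "i < r" for i
    using w[of i] wn0[OF that] by (auto simp: line_def lines_through_origin_def)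
  have ipc: "scalar_prod (c \<cdot>\<^sub>v w i) (d \<cdot>\<^sub>v w j) = c * d * scalar_prod (w i) (w j)" for c d i j
    using smult_scalar_prod_distrib[OF w smult_carrier_vec[THEN iffD2, OF w], of c i d j]
      scalar_prod_smult_distrib[OF w w, of i d j] by (simp only: mult.assoc)
  have angle: "acute_angle u v = arccos \<alpha>"
    if ij: "i < r" "j < r" "i \<noteq> j" and uv: "u \<in> line i - {0\<^sub>v r}" "v \<in> line j - {0\<^sub>v r}" for i j u v
  proof -
    obtain c d where c: "u = c \<cdot>\<^sub>v w i" "v = d \<cdot>\<^sub>v w j" using uv by (auto simp: line_def)
    have "c \<noteq> 0" "d \<noteq> 0" using uv c by (auto simp: w_def)
    then show ?thesis
      unfolding acute_angle_def euclid_norm_def c ipc using ij assms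
      by (simp add: ip abs_mult real_sqrt_mult)
  qed
  have inj: "inj_on line {..<r}"
  proof (rule inj_onI, rule ccontr)
    fix i j assume ij: "i \<in> {..<r}" "j \<in> {..<r}" "line i = line j" "i \<noteq> j"
    \<comment> \<open>If two of the lines coincided, \<open>w i\<close> would make the angle
      \<open>arccos \<alpha>\<close> with itself, although that angle is 0.\<close>
    have "w i \<in> line i" by (auto simp: line_def intro!: exI[of _ 1])
    with angle[of i j "w i" "w i"] ij wn0 have "arccos \<alpha> = acute_angle (w i) (w i)" by simp
    also have "\<dots> = 0" using ip[of i i] ij by (simp add: acute_angle_def euclid_norm_def)
    finally have "arccos \<alpha> = arccos 1" by simp
    then show False using assms arccos_eq_iff[of \<alpha> 1] by simp
  qed
  have "equiangular \<alpha> r (line ` {..<r})"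
    unfolding equiangular_def
  proof (intro conjI ballI impI)
    show "line ` {..<r} \<subseteq> lines_through_origin r" using lines by auto
  next
    fix l m u v
    assume "l \<in> line ` {..<r}" "m \<in> line ` {..<r}" "l \<noteq> m" and uv: "u \<in> l - {0\<^sub>v r}" "v \<in> m - {0\<^sub>v r}"
    then obtain i j where "i < r" "j < r" "l = line i" "m = line j" "i \<noteq> j" by auto
    then show "acute_angle u v = arccos \<alpha>" using angle uv by blast
  qed
  then show ?thesis using inj by (intro exI[of _ "line ` {..<r}"]) (simp add: card_image)
qed

text \<open>The bound \<open>B\<close> makes the set of sizes finite and the family of
  \<open>r\<close> lines makes it nonempty, so \<open>Max\<close> is a true maximum.\<close>

lemma max_equiangular_bounds:
  assumes "0 < \<alpha>" "\<alpha> < 1" "r > 0"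
    and bound: "\<And>L. finite L \<Longrightarrow> equiangular \<alpha> r L \<Longrightarrow> real (card L) \<le> B"
  shows "r \<le> max_equiangular \<alpha> r" "real (max_equiangular \<alpha> r) \<le> B"
proof -
  define F where "F = {card L | L. finite L \<and> equiangular \<alpha> r L}"
  have "r \<in> F" using equiangular_exists[OF assms(1-3)] by (force simp: F_def)
  have le: "real n \<le> B" if "n \<in> F" for n using that bound by (auto simp: F_def)
  have "F \<subseteq> {..nat \<lfloor>B\<rfloor>}" using le by (auto simp: le_nat_floor)
  then have fin: "finite F" by (rule finite_subset) simp
  show "r \<le> max_equiangular \<alpha> r"
    using Max_ge[OF fin \<open>r \<in> F\<close>] by (simp add: max_equiangular_def F_def)
  show "real (max_equiangular \<alpha> r) \<le> B"
    using le[OF Max_in[OF fin]] \<open>r \<in> F\<close> by (auto simp: max_equiangular_def F_def)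
qed

theorem theorem1p1:
  fixes \<alpha> :: "nat \<Rightarrow> real" and r :: "nat \<Rightarrow> nat" and \<omega> :: "nat \<Rightarrow> real"
  assumes "\<And>j. j \<ge> 1 \<Longrightarrow> 0 < \<alpha> j \<and> \<alpha> j < 1"
    and "\<alpha> \<longlonglongrightarrow> 0"
    and "\<And>j. j \<ge> 1 \<Longrightarrow> r j > 0"
    and "filterlim \<omega> at_top sequentially"
    and "\<And>j. j \<ge> 1 \<Longrightarrow> real (r j) \<ge> (1 / \<alpha> j) powr \<omega> j"
  shows "(\<lambda>j. real (max_equiangular (\<alpha> j) (r j)) - real (r j)) \<in> o(\<lambda>j. real (r j))"
proof (rule landau_o.smallI)
  fix c :: real assume "c > 0"
  \<comment> \<open>Half of \<open>c\<close> is for the factor \<open>1 + \<epsilon>\<close>, half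
    for the polynomial term.\<close>
  define \<epsilon> where "\<epsilon> = min 1 (c / 2)"
  have \<epsilon>: "0 < \<epsilon>" "\<epsilon> \<le> 1" "2 * \<epsilon> \<le> c" using \<open>c > 0\<close> by (auto simp: \<epsilon>_def)
  obtain C M A0 where bound: "\<forall>\<alpha> r V (X :: real vec set \<Rightarrow> nat \<Rightarrow> real). 0 < \<alpha> \<longrightarrow> A0 \<le> 1 / \<alpha> \<longrightarrow> finite V \<longrightarrow>
    (\<forall>v\<in>V. inner_upto r (X v) (X v) = 1) \<longrightarrow>
    (\<forall>u\<in>V. \<forall>v\<in>V. u \<noteq> v \<longrightarrow> \<bar>inner_upto r (X u) (X v)\<bar> = \<alpha>) \<longrightarrow>
    real (card V) \<le> (1 + \<epsilon>) * real r + C * (1 / \<alpha>) ^ M"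
    using equiangular_vectors_card_le[OF \<epsilon>(1,2)] by (elim exE)
  define A where "A = max 1 (max A0 (C / \<epsilon>))"
  have "\<forall>\<^sub>F j in sequentially. \<alpha> j < 1 / A"
    using order_tendstoD(2)[OF assms(2), of "1 / A"] by (simp add: A_def)
  moreover have "\<forall>\<^sub>F j in sequentially. real (Suc M) \<le> \<omega> j"
    using assms(4) by (simp add: filterlim_at_top)
  moreover have "\<forall>\<^sub>F j in sequentially. j \<ge> 1" by (rule eventually_ge_at_top)
  ultimately show "\<forall>\<^sub>F j in sequentially.
    norm (real (max_equiangular (\<alpha> j) (r j)) - real (r j)) \<le> c * norm (real (r j))"
  proof eventually_elim
    case (elim j)
    have \<alpha>: "0 < \<alpha> j" "\<alpha> j < 1" and r: "r j > 0" using assms(1,3) elim(3) by auto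
    define a where "a = 1 / \<alpha> j"
    have "A > 0" by (simp add: A_def)
    then have "A \<le> a" using elim(1) \<alpha> by (simp add: a_def field_simps)
    then have a: "1 \<le> a" "A0 \<le> a" "C / \<epsilon> \<le> a" by (simp_all add: A_def)
    \<comment> \<open>One spare factor \<open>a \<ge> C / \<epsilon>\<close> absorbs the constant;
      this is why \<omega> is taken to be at least \<open>M + 1\<close>.\<close>
    have "C * a ^ M \<le> \<epsilon> * a * a ^ M"
      using a \<epsilon> by (intro mult_right_mono) (auto simp: field_simps)
    also have "\<dots> = \<epsilon> * a powr real (Suc M)"
      using a powr_realpow[of a "Suc M"] by (simp del: of_nat_Suc)
    also have "\<dots> \<le> \<epsilon> * a powr \<omega> j" using a \<epsilon> elim(2) by (intro mult_left_mono powr_mono) auto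
    also have "\<dots> \<le> \<epsilon> * real (r j)"
      using assms(5)[OF elim(3)] \<epsilon> by (intro mult_left_mono) (auto simp: a_def)
    finally have Ca: "C * a ^ M \<le> \<epsilon> * real (r j)" .
    have le: "real (card L) \<le> real (r j) + c * real (r j)" if L: "finite L" "equiangular (\<alpha> j) (r j) L" for L
    proof -
      obtain X where "\<forall>l\<in>L. inner_upto (r j) (X l) (X l) = 1"
        "\<forall>l\<in>L. \<forall>m\<in>L. l \<noteq> m \<longrightarrow> \<bar>inner_upto (r j) (X l) (X m)\<bar> = \<alpha> j"
        using equiangular_lines_unit_vectors[OF L(2)] \<alpha> by auto
      with bound \<alpha>(1) L(1) a(2) have "real (card L) \<le> (1 + \<epsilon>) * real (r j) + C * a ^ M"
        unfolding a_def by blast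
      also have "\<dots> \<le> real (r j) + (2 * \<epsilon>) * real (r j)" using Ca by (simp add: algebra_simps)
      also have "\<dots> \<le> real (r j) + c * real (r j)" using \<epsilon> by (intro add_left_mono mult_right_mono) auto
      finally show ?thesis .
    qed
    have "real (r j) \<le> real (max_equiangular (\<alpha> j) (r j))"
      using max_equiangular_bounds(1)[OF \<alpha> r le] by simp
    moreover have "real (max_equiangular (\<alpha> j) (r j)) \<le> real (r j) + c * real (r j)"
      using max_equiangular_bounds(2)[OF \<alpha> r le] .
    ultimately show ?case by simp
  qed
qed

end
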